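(* For every $1\neq[\overline{\alpha}]\in\pi_1(\overline{\mathbb{T}},\ast)$, there is a covering projection $r:(E,e)\to(\overline{\mathbb{T}},\ast)$ such that $[\overline{\alpha}]\notin r_\#\pi_1(E,e)$.
   Context: For each $m\in\mathbb{N}=\{1,2,3,\dots\}$ let $C_m\subseteq\mathbb{R}^2$ be the circle of radius $\frac1m$ centered at $(\frac1m,0)$; let $\mathbb{E}=\bigcup_{m\in\mathbb{N}}C_m\subseteq\mathbb{R}^2$ (subspace topology) with basepoint $\ast=(0,0)$. Let $\ell_m:[0,1]\to C_m$ be the loop $\ell_m(t)=\left(\frac1m(1-\cos 2\pi t),\frac1m\sin 2\pi t\right)$. Let $f:\mathbb{E}\to\mathbb{E}$ be the unique continuous map with $f\circ\ell_m=\ell_{m+1}$ for all $m\in\mathbb{N}$. For each $i\in\mathbb{Z}$ let $X_i$ be a copy of $\mathbb{E}$ and let $f_i=f:X_i\to X_{i+1}$. Let $\overline{\mathbb{T}}$ be the mapping telescope of the bi-infinite sequence $\cdots\to X_{-1}\to X_0\to X_1\to\cdots$ with maps $f_i$, i.e. the quotient of the disjoint union $\sum_{i\in\mathbb{Z}}X_i\times[0,1]$ by $(x,1)\sim(f_i(x),0)$ for all $i\in\mathbb{Z}$, $x\in X_i$ (where $(x,1)\in X_i\times[0,1]$ and $(f_i(x),0)\in X_{i+1}\times[0,1]$), with quotient map $\overline{h}$. Identify $X_i$ with $\overline{h}(X_i\times\{0\})$; the basepoint of $\overline{\mathbb{T}}$ is $\ast\in X_0$. *)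

theory Defs
  imports "HOL-Analysis.Analysis" "HOL-Algebra.Group"
begin

definition earring_circle :: "nat \<Rightarrow> (real \<times> real) set" where
  "earring_circle m = sphere (1 / real m, 0) (1 / real m)"

definition earring :: "(real \<times> real) set" where
  "earring = (\<Union>m\<in>{1..}. earring_circle m)"

definition earring_loop :: "nat \<Rightarrow> real \<Rightarrow> real \<times> real" where
  "earring_loop m t = ((1 - cos (2 * pi * t)) / real m, sin (2 * pi * t) / real m)"

text \<open>
  A self-map of the earring is a total function on \<open>real \<times> real\<close>; membership in
  \<open>extensional earring\<close> only fixes the irrelevant values off the earring, so that the map
  is unique.
\<close>

definition is_earring_shift :: "(real \<times> real \<Rightarrow> real \<times> real) \<Rightarrow> bool" where
  "is_earring_shift g \<longleftrightarrow>
     g \<in> extensional earring \<and>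
     continuous_map (top_of_set earring) (top_of_set earring) g \<and>
     (\<forall>m\<ge>1. \<forall>t\<in>{0..1}. g (earring_loop m t) = earring_loop (m + 1) t)"

definition earring_shift :: "real \<times> real \<Rightarrow> real \<times> real" where
  "earring_shift = (THE g. is_earring_shift g)"

lemma earring_circle_iff:
  assumes "m \<ge> 1"
  shows "(x, y) \<in> earring_circle m \<longleftrightarrow> real m * (x\<^sup>2 + y\<^sup>2) = 2 * x"
proof -
  have m: "real m > 0" using assms by simp
  have "(x, y) \<in> earring_circle m \<longleftrightarrow> sqrt ((1 / real m - x)\<^sup>2 + y\<^sup>2) = 1 / real m"
    by (simp add: earring_circle_def dist_Pair_Pair dist_real_def)
  also have "\<dots> \<longleftrightarrow> (1 / real m - x)\<^sup>2 + y\<^sup>2 = (1 / real m)\<^sup>2"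
    using m real_sqrt_eq_iff[of "(1 / real m - x)\<^sup>2 + y\<^sup>2" "(1 / real m)\<^sup>2"]
    by simp
  also have "\<dots> \<longleftrightarrow> real m * (x\<^sup>2 + y\<^sup>2) = 2 * x"
  proof -
    have "(1 / real m - x)\<^sup>2 + y\<^sup>2 - (1 / real m)\<^sup>2 = (real m * (x\<^sup>2 + y\<^sup>2) - 2 * x) / real m"
      using m by (simp add: power2_eq_square field_simps)
    then show ?thesis using m by (smt (verit) divide_eq_0_iff)
  qed
  finally show ?thesis .
qed

lemma earring_loop_in_circle:
  assumes "m \<ge> 1" shows "earring_loop m t \<in> earring_circle m"
proof -
  have m: "real m > 0" using assms by simp
  have s: "(sin (2 * pi * t))\<^sup>2 = 1 - (cos (2 * pi * t))\<^sup>2"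
    by (simp add: sin_squared_eq)
  have "real m * (((1 - cos (2 * pi * t)) / real m)\<^sup>2 + (sin (2 * pi * t) / real m)\<^sup>2)
      = ((1 - cos (2 * pi * t))\<^sup>2 + (sin (2 * pi * t))\<^sup>2) / real m"
    using m by (simp add: power2_eq_square field_simps)
  also have "\<dots> = 2 * ((1 - cos (2 * pi * t)) / real m)"
    unfolding s by (simp add: power2_eq_square algebra_simps)
  finally show ?thesis
    using assms by (simp add: earring_loop_def earring_circle_iff)
qed

lemma earring_loop_surj:
  assumes "m \<ge> 1" "p \<in> earring_circle m"
  shows "\<exists>t\<in>{0..1}. p = earring_loop m t"
proof -
  obtain x y where p: "p = (x, y)" by (cases p)
  have m: "real m > 0" using assms by simp
  have e: "real m * (x\<^sup>2 + y\<^sup>2) = 2 * x"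
    using assms p earring_circle_iff by blast
  have "(1 - real m * x)\<^sup>2 + (real m * y)\<^sup>2 = 1 - 2 * (real m * x) + real m * (real m * (x\<^sup>2 + y\<^sup>2))"
    by (simp add: power2_eq_square algebra_simps)
  also have "\<dots> = 1" unfolding e by simp
  finally obtain s where s: "0 \<le> s" "s < 2 * pi" "1 - real m * x = cos s" "real m * y = sin s"
    using sincos_total_2pi by metis
  have "2 * pi * (s / (2 * pi)) = s" by simp
  moreover have "x = (1 - cos s) / real m" "y = sin s / real m"
    using s m by (simp_all add: field_simps)
  ultimately have "p = earring_loop m (s / (2 * pi))"
    by (simp add: p earring_loop_def)
  moreover have "s / (2 * pi) \<in> {0..1}" using s by (simp add: field_simps)
  ultimately show ?thesis by blast
qed

lemma earring_loop_cases:
  assumes "p \<in> earring"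
  obtains m t where "m \<ge> 1" "t \<in> {0..1}" "p = earring_loop m t"
proof -
  obtain m where "m \<ge> 1" "p \<in> earring_circle m"
    using assms unfolding earring_def by auto
  then show ?thesis using earring_loop_surj that by blast
qed

lemma ex1_earring_shift: "\<exists>!g. is_earring_shift g"
proof (rule ex_ex1I)
  define h :: "real \<times> real \<Rightarrow> real \<times> real" where
    "h = (\<lambda>p. (2 * fst p / (2 * fst p + (fst p)\<^sup>2 + (snd p)\<^sup>2)) *\<^sub>R p)"
  define g where "g = restrict h earring"
  have pos: "fst p > 0" if p: "p \<in> earring" "p \<noteq> 0" for p
  proof -
    obtain m where m: "m \<ge> 1" "p \<in> earring_circle m" using p by (auto simp: earring_def)
    have "real m * ((fst p)\<^sup>2 + (snd p)\<^sup>2) = 2 * fst p"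
      using m earring_circle_iff[of m "fst p" "snd p"] by simp
    moreover have "(fst p)\<^sup>2 + (snd p)\<^sup>2 > 0"
      using p(2) by (auto simp: sum_power2_gt_zero_iff prod_eq_iff)
    ultimately show ?thesis using m(1) by (smt (verit) mult_pos_pos of_nat_0_less_iff less_le_trans zero_less_one)
  qed
  have loop: "h (earring_loop m t) = earring_loop (m + 1) t" if m: "m \<ge> 1" for m t
  proof (cases "earring_loop m t = 0")
    case True
    then show ?thesis using m by (simp add: h_def earring_loop_def zero_prod_def)
  next
    case False
    define x y where "x = fst (earring_loop m t)" and "y = snd (earring_loop m t)"
    have mem: "earring_loop m t \<in> earring_circle m" using earring_loop_in_circle[OF m] .
    then have e: "real m * (x\<^sup>2 + y\<^sup>2) = 2 * x"
      using earring_circle_iff[OF m, of x y] by (simp add: x_def y_def)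
    have x: "x > 0" unfolding x_def using pos[of "earring_loop m t"] False mem m
      by (auto simp: earring_def)
    have m0: "real m > 0" using m by simp
    have "x\<^sup>2 + y\<^sup>2 = 2 * x / real m" using e m0 by (simp add: field_simps)
    then have D: "2 * x + x\<^sup>2 + y\<^sup>2 = 2 * x * (real m + 1) / real m"
      using m0 by (simp add: field_simps)
    have "2 * x / (2 * x + x\<^sup>2 + y\<^sup>2) = real m / (real m + 1)"
      unfolding D using x m0 by (simp add: divide_simps)
    then have "h (earring_loop m t) = (real m / (real m + 1)) *\<^sub>R earring_loop m t"
      by (simp add: h_def x_def y_def)
    also have "\<dots> = earring_loop (m + 1) t"
      using m0 by (simp add: earring_loop_def add.commute)
    finally show ?thesis .
  qed
  have loopE: "earring_loop m t \<in> earring" if "m \<ge> 1" for m t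
    using earring_loop_in_circle[OF that] that by (auto simp: earring_def)
  have maps: "h p \<in> earring" if p: "p \<in> earring" for p
  proof -
    obtain m t where "m \<ge> 1" "p = earring_loop m t"
      using p by (rule earring_loop_cases)
    then show ?thesis using loop loopE by simp
  qed
  have bound: "norm (h p) \<le> norm p" if p: "p \<in> earring" for p
  proof (cases "p = 0")
    case True then show ?thesis by (simp add: h_def)
  next
    case False
    then have "fst p > 0" using pos p by blast
    then have "\<bar>2 * fst p / (2 * fst p + (fst p)\<^sup>2 + (snd p)\<^sup>2)\<bar> \<le> 1"
      by (simp add: field_simps add_pos_nonneg)
    then show ?thesis by (simp add: h_def mult_left_le_one_le del: abs_divide)
  qed
  have cont: "continuous_on earring h"
  proof (clarsimp simp: continuous_on_eq_continuous_within)
    fix a b assume ab: "(a, b) \<in> earring"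
    show "continuous (at (a, b) within earring) h"
    proof (cases "(a, b) = (0 :: real \<times> real)")
      case True
      have "(h \<longlongrightarrow> 0) (at (0 :: real \<times> real) within earring)"
      proof (rule Lim_null_comparison)
        show "\<forall>\<^sub>F p in at 0 within earring. norm (h p) \<le> norm p"
          using bound by (auto simp: eventually_at_filter)
        show "((\<lambda>p::real \<times> real. norm p) \<longlongrightarrow> 0) (at 0 within earring)"
          by (intro tendsto_norm_zero tendsto_ident_at)
      qed
      then show ?thesis unfolding True continuous_within by (simp add: h_def)
    next
      case False
      then have "a > 0" using pos[OF ab] by simp
      then have "2 * a + a\<^sup>2 + b\<^sup>2 > 0" by (simp add: add_pos_nonneg)
      then show ?thesis unfolding h_def continuous_within
        by (intro tendsto_intros) auto
    qed
  qed
  have "continuous_on earring g"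
    using cont by (rule continuous_on_eq) (simp add: g_def)
  then have "is_earring_shift g"
    unfolding is_earring_shift_def using maps loop loopE by (auto simp: g_def)
  then show "\<exists>g. is_earring_shift g" by blast
next
  fix g g' assume g: "is_earring_shift g" "is_earring_shift g'"
  show "g = g'"
  proof (rule extensionalityI)
    show "g \<in> extensional earring" "g' \<in> extensional earring"
      using g by (simp_all add: is_earring_shift_def)
    fix p assume "p \<in> earring"
    then obtain m t where "m \<ge> 1" "t \<in> {0..1}" "p = earring_loop m t"
      by (rule earring_loop_cases)
    then show "g p = g' p" using g by (simp add: is_earring_shift_def)
  qed
qed

lemma is_earring_shift_earring_shift: "is_earring_shift earring_shift"
  unfolding earring_shift_def using ex1_earring_shift by (rule theI')

text \<open>
  The quotient of \<open>X\<close> by the equivalence relation generated by \<open>r\<close>, where \<open>r\<close> is assumed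
  to relate only points of \<open>X\<close>.
\<close>

definition quotient_proj :: "('a \<Rightarrow> 'a \<Rightarrow> bool) \<Rightarrow> 'a \<Rightarrow> 'a set" where
  "quotient_proj r x = {y. equivclp r x y}"

definition quotient_topology :: "'a topology \<Rightarrow> ('a \<Rightarrow> 'a \<Rightarrow> bool) \<Rightarrow> 'a set topology" where
  "quotient_topology X r =
     topology (\<lambda>U. U \<subseteq> quotient_proj r ` topspace X \<and>
                   openin X {x \<in> topspace X. quotient_proj r x \<in> U})"

lemma openin_quotient_topology:
  "openin (quotient_topology X r) U \<longleftrightarrow>
     U \<subseteq> quotient_proj r ` topspace X \<and> openin X {x \<in> topspace X. quotient_proj r x \<in> U}"
proof -
  let ?q = "quotient_proj r"
  have "{x \<in> topspace X. ?q x \<in> S \<inter> T} = {x \<in> topspace X. ?q x \<in> S} \<inter> {x \<in> topspace X. ?q x \<in> T}"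
    for S T by auto
  moreover have "{x \<in> topspace X. ?q x \<in> \<Union>\<K>} = (\<Union>K\<in>\<K>. {x \<in> topspace X. ?q x \<in> K})" for \<K>
    by auto
  ultimately have "istopology (\<lambda>U. U \<subseteq> ?q ` topspace X \<and> openin X {x \<in> topspace X. ?q x \<in> U})"
    unfolding istopology_def by (auto simp del: UN_simps)
  then show ?thesis by (simp add: quotient_topology_def topology_inverse')
qed

lemma topspace_quotient_topology:
  "topspace (quotient_topology X r) = quotient_proj r ` topspace X"
proof -
  have "{x \<in> topspace X. quotient_proj r x \<in> quotient_proj r ` topspace X} = topspace X" by auto
  then have "openin (quotient_topology X r) (quotient_proj r ` topspace X)"
    by (simp add: openin_quotient_topology)
  then show ?thesis
    by (metis openin_quotient_topology openin_subset openin_topspace subset_antisym)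
qed

lemma quotient_map_quotient_proj: "quotient_map X (quotient_topology X r) (quotient_proj r)"
  by (auto simp: quotient_map_def topspace_quotient_topology openin_quotient_topology)

type_synonym cylinder_point = "int \<times> ((real \<times> real) \<times> real)"
type_synonym telescope_point = "cylinder_point set"

definition telescope_cylinders :: "cylinder_point topology" where
  "telescope_cylinders =
     sum_topology (\<lambda>i. prod_topology (top_of_set earring) (top_of_set {0..1})) UNIV"

definition telescope_glue :: "cylinder_point \<Rightarrow> cylinder_point \<Rightarrow> bool" where
  "telescope_glue p q \<longleftrightarrow>
     (\<exists>i. \<exists>x\<in>earring. p = (i, (x, 1)) \<and> q = (i + 1, (earring_shift x, 0)))"

definition telescope :: "telescope_point topology" where
  "telescope = quotient_topology telescope_cylinders telescope_glue"

definition telescope_base :: telescope_point where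
  "telescope_base = quotient_proj telescope_glue (0, ((0, 0), 0))"

text \<open>
  Loops are total functions on the reals of which only the restriction to the unit interval
  matters: functions that agree there are path-homotopic by definition of
  \<open>homotopic_with\<close>, hence lie in the same class.
\<close>

definition loops_at :: "'a topology \<Rightarrow> 'a \<Rightarrow> (real \<Rightarrow> 'a) set" where
  "loops_at X x = {p. pathin X p \<and> p 0 = x \<and> p 1 = x}"

definition loop_class :: "'a topology \<Rightarrow> 'a \<Rightarrow> (real \<Rightarrow> 'a) \<Rightarrow> (real \<Rightarrow> 'a) set" where
  "loop_class X x p =
     {q. homotopic_with (\<lambda>h. h 0 = x \<and> h 1 = x) (top_of_set {0..1}) X p q}"

text \<open>\<^const>\<open>joinpaths\<close> is not available here, as its type requires a type-class topology.\<close>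

definition loop_concat :: "(real \<Rightarrow> 'a) \<Rightarrow> (real \<Rightarrow> 'a) \<Rightarrow> real \<Rightarrow> 'a" where
  "loop_concat p q t = (if t \<le> 1/2 then p (2 * t) else q (2 * t - 1))"

definition fundamental_group :: "'a topology \<Rightarrow> 'a \<Rightarrow> (real \<Rightarrow> 'a) set monoid" where
  "fundamental_group X x =
     \<lparr>carrier = loop_class X x ` loops_at X x,
      monoid.mult = (\<lambda>A B. \<Union>p\<in>A. \<Union>q\<in>B. loop_class X x (loop_concat p q)),
      one = loop_class X x (\<lambda>_. x)\<rparr>"

definition induced_hom ::
  "'a topology \<Rightarrow> ('b \<Rightarrow> 'a) \<Rightarrow> 'b \<Rightarrow> (real \<Rightarrow> 'b) set \<Rightarrow> (real \<Rightarrow> 'a) set" where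
  "induced_hom X r e A = (\<Union>p\<in>A. loop_class X (r e) (r \<circ> p))"

definition covering_projection :: "'b topology \<Rightarrow> ('b \<Rightarrow> 'a) \<Rightarrow> 'a topology \<Rightarrow> bool" where
  "covering_projection E r X \<longleftrightarrow>
     continuous_map E X r \<and> r ` topspace E = topspace X \<and>
     (\<forall>x\<in>topspace X. \<exists>U. x \<in> U \<and> openin X U \<and>
        (\<exists>\<V>. \<Union>\<V> = {e \<in> topspace E. r e \<in> U} \<and>
             (\<forall>V\<in>\<V>. openin E V) \<and>
             pairwise disjnt \<V> \<and>
             (\<forall>V\<in>\<V>. homeomorphic_map (subtopology E V) (subtopology X U) r)))"

text \<open>
  HOL cannot quantify existentially over the type of points of a covering space, so one type
  is fixed that is large enough for all of them. Given a covering projection \<open>r\<close> of the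
  telescope by any space, with base point \<open>e\<close> over the base point, the path component of \<open>e\<close>
  is again a covering of the (path-connected, locally path-connected) telescope with the same
  image of its fundamental group, and sending a point \<open>z\<close> of it to the set of those paths in the
  telescope whose lifts at \<open>e\<close> end at \<open>z\<close> is injective.
\<close>

type_synonym telescope_cover_point = "(real \<Rightarrow> telescope_point) set"

end

theory Submission
  imports Defs "HOL-Library.Sublist" "HOL-Complex_Analysis.Great_Picard"
begin

text \<open>
  The maps of the telescope only relabel circles, so the telescope carries one circle \<open>c\<^sub>n\<close> for every
  integer \<open>n\<close>, present from height \<open>1 - n\<close> on. Collapsing all \<open>c\<^sub>n\<close> with \<open>n > k\<close> and unwrapping the
  others gives a covering whose points lie over the Cayley tree of the free group on the
  \<open>c\<^sub>n\<close>, \<open>n \<le> k\<close>. If the class of a loop lies in the image of the fundamental group of each of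
  these coverings, then the loop lifts to closed loops in all of them. Give the edges labelled \<open>n\<close>
  a weight \<open>\<omega> n\<close> so small that, uniformly in \<open>k\<close>, the lifts have bounded and
  equicontinuous distance from the root. A limit \<open>h\<close> of these heights (Arzela--Ascoli) has the
  property that \<open>h s = h t = min h\<close> on \<open>[s, t]\<close> forces the loop to be at the same place
  of the same circle at the times \<open>s\<close> and \<open>t\<close>, because in a tree the path from \<open>s\<close> to \<open>t\<close> passes
  through the meet of its end points. Hence the loop, pushed up to constant height,
  factors through the real tree coded by \<open>h\<close>, which is contractible.
\<close>

section \<open>Loops coded by real trees\<close>

lemma level_ancestor_exists:
  fixes h :: "real \<Rightarrow> real"
  assumes h: "continuous_on {0..1} h" "h 0 = 0" and t: "t \<in> {0..1}" and m: "0 \<le> m" "m \<le> h t"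
  obtains s where "s \<in> {0..t}" "h s = m" "\<And>r. r \<in> {s..t} \<Longrightarrow> m \<le> h r"
proof -
  define Z where "Z = {s \<in> {0..t}. h s = m}"
  have ct: "continuous_on {0..t} h"
    using h(1) t by (auto elim: continuous_on_subset)
  have "Z \<noteq> {}"
    using IVT'[of h 0 m t] h(2) m t ct by (auto simp: Z_def)
  have cl: "closed Z"
    unfolding Z_def using continuous_closed_preimage_constant[OF ct] by simp
  have bd: "bdd_above Z" by (auto simp: Z_def)
  define s where "s = Sup Z"
  have s: "s \<in> Z" unfolding s_def using closed_contains_Sup[OF \<open>Z \<noteq> {}\<close> bd cl] .
  have "m \<le> h r" if r: "r \<in> {s..t}" for r
  proof (rule ccontr)
    assume "\<not> m \<le> h r"
    moreover have "continuous_on {r..t} h"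
      using r s by (intro continuous_on_subset[OF ct]) (auto simp: Z_def)
    ultimately obtain x where "r \<le> x" "x \<le> t" "h x = m"
      using IVT'[of h r m t] r m by auto
    moreover from this have "x \<in> Z" using r s by (auto simp: Z_def)
    ultimately have "x \<le> s" "r \<le> x" unfolding s_def using cSup_upper[OF _ bd] by auto
    then have "r = s" using r by auto
    then show False using \<open>\<not> m \<le> h r\<close> s by (auto simp: Z_def)
  qed
  then show ?thesis using that s by (auto simp: Z_def)
qed

lemma tree_coded_path_modulus:
  fixes h :: "real \<Rightarrow> real" and \<beta> :: "real \<Rightarrow> 'a::metric_space"
  assumes \<beta>: "continuous_on {0..1} \<beta>" and h: "continuous_on {0..1} h"
    and fact: "\<And>s t. 0 \<le> s \<Longrightarrow> s \<le> t \<Longrightarrow> t \<le> 1 \<Longrightarrow> h s = h t \<Longrightarrow>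
                 \<forall>r\<in>{s..t}. h s \<le> h r \<Longrightarrow> \<beta> s = \<beta> t"
    and e: "e > 0"
  shows "\<exists>d>0. \<forall>s t. 0 \<le> s \<longrightarrow> s \<le> t \<longrightarrow> t \<le> 1 \<longrightarrow>
           (\<forall>r\<in>{s..t}. h s - d \<le> h r \<and> h t - d \<le> h r) \<longrightarrow> dist (\<beta> s) (\<beta> t) < e"
proof (rule ccontr)
  assume neg: "\<not> ?thesis"
  have "\<exists>z. 0 \<le> fst z \<and> fst z \<le> snd z \<and> snd z \<le> 1 \<and>
           (\<forall>r\<in>{fst z..snd z}. h (fst z) - 1 / Suc j \<le> h r \<and> h (snd z) - 1 / Suc j \<le> h r) \<and>
           dist (\<beta> (fst z)) (\<beta> (snd z)) \<ge> e" for j :: nat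
  proof -
    have "(1 :: real) / Suc j > 0" by simp
    with neg obtain s t where "0 \<le> s" "s \<le> t" "t \<le> 1"
        "\<forall>r\<in>{s..t}. h s - 1 / Suc j \<le> h r \<and> h t - 1 / Suc j \<le> h r" "\<not> dist (\<beta> s) (\<beta> t) < e"
      by meson
    then show ?thesis by (intro exI[of _ "(s, t)"]) (simp del: of_nat_Suc)
  qed
  then obtain z :: "nat \<Rightarrow> real \<times> real" where z: "\<And>j. 0 \<le> fst (z j)" "\<And>j. fst (z j) \<le> snd (z j)"
    "\<And>j. snd (z j) \<le> 1"
    "\<And>j r. r \<in> {fst (z j)..snd (z j)} \<Longrightarrow> h (fst (z j)) - 1 / Suc j \<le> h r \<and> h (snd (z j)) - 1 / Suc j \<le> h r"
    "\<And>j. dist (\<beta> (fst (z j))) (\<beta> (snd (z j))) \<ge> e"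
    by metis
  have "compact ({0..1::real} \<times> {0..1::real})" by (intro compact_Times) auto
  moreover have "\<forall>j. z j \<in> {0..1} \<times> {0..1}"
    using z(1-3) by (auto simp: mem_Times_iff intro: order_trans)
  ultimately obtain l r where l: "l \<in> {0..1} \<times> {0..1}" and r: "strict_mono (r :: nat \<Rightarrow> nat)" "(z \<circ> r) \<longlonglongrightarrow> l"
    unfolding compact_def by metis
  define s t where "s = fst l" and "t = snd l"
  have st: "s \<in> {0..1}" "t \<in> {0..1}" using l by (auto simp: s_def t_def mem_Times_iff)
  have lims: "(\<lambda>j. fst (z (r j))) \<longlonglongrightarrow> s" and limt: "(\<lambda>j. snd (z (r j))) \<longlonglongrightarrow> t"
    using tendsto_fst[OF r(2)] tendsto_snd[OF r(2)] by (auto simp: s_def t_def o_def)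
  have le: "s \<le> t" using LIMSEQ_le[OF lims limt] z(2) by blast
  have in01: "\<forall>\<^sub>F j in sequentially. fst (z (r j)) \<in> {0..1}" "\<forall>\<^sub>F j in sequentially. snd (z (r j)) \<in> {0..1}"
    using z(1-3) by (auto intro!: always_eventually intro: order_trans)
  have hs: "(\<lambda>j. h (fst (z (r j)))) \<longlonglongrightarrow> h s" and ht: "(\<lambda>j. h (snd (z (r j)))) \<longlonglongrightarrow> h t"
    using continuous_on_tendsto_compose[OF h lims st(1) in01(1)]
      continuous_on_tendsto_compose[OF h limt st(2) in01(2)] by auto
  have inv: "(\<lambda>j. 1 / real (Suc (r j))) \<longlonglongrightarrow> 0"
    using LIMSEQ_subseq_LIMSEQ[OF LIMSEQ_Suc[OF lim_1_over_n] r(1)] by (simp add: o_def)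
  have mid: "h s \<le> h x \<and> h t \<le> h x" if x: "s < x" "x < t" for x
  proof -
    have ev: "\<forall>\<^sub>F j in sequentially. x \<in> {fst (z (r j))..snd (z (r j))}"
      using order_tendstoD(2)[OF lims x(1)] order_tendstoD(1)[OF limt x(2)] by eventually_elim auto
    have "h s - 0 \<le> h x"
      by (rule tendsto_upperbound[OF tendsto_diff[OF hs inv]], rule eventually_mono[OF ev])
        (use z(4) in auto)
    moreover have "h t - 0 \<le> h x"
      by (rule tendsto_upperbound[OF tendsto_diff[OF ht inv]], rule eventually_mono[OF ev])
        (use z(4) in auto)
    ultimately show ?thesis by simp
  qed
  have "\<beta> s = \<beta> t"
  proof (cases "s = t")
    case False
    then have lt: "s < t" using le by simp
    have clos: "closed {x \<in> {s..t}. h s \<le> h x \<and> h t \<le> h x}"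
    proof -
      have c: "continuous_on {s..t} h" using h st by (auto elim: continuous_on_subset)
      have "closed ({s..t} \<inter> h -` {max (h s) (h t)..})"
        using continuous_closed_preimage[OF c closed_real_atLeastAtMost closed_atLeast] .
      moreover have "{s..t} \<inter> h -` {max (h s) (h t)..} = {x \<in> {s..t}. h s \<le> h x \<and> h t \<le> h x}"
        by auto
      ultimately show ?thesis by simp
    qed
    have "{s<..<t} \<subseteq> {x \<in> {s..t}. h s \<le> h x \<and> h t \<le> h x}" using mid by auto
    then have "closure {s<..<t} \<subseteq> {x \<in> {s..t}. h s \<le> h x \<and> h t \<le> h x}"
      using clos closure_minimal by blast
    then have all: "h s \<le> h x \<and> h t \<le> h x" if "x \<in> {s..t}" for x
      using that lt by (auto simp: closure_greaterThanLessThan)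
    have "h s = h t" using all[of s] all[of t] le by simp
    then show ?thesis using fact[of s t] st le all by auto
  qed simp
  moreover have "(\<lambda>j. dist (\<beta> (fst (z (r j)))) (\<beta> (snd (z (r j))))) \<longlonglongrightarrow> dist (\<beta> s) (\<beta> t)"
    by (intro tendsto_dist continuous_on_tendsto_compose[OF \<beta> lims st(1) in01(1)]
        continuous_on_tendsto_compose[OF \<beta> limt st(2) in01(2)])
  then have "e \<le> dist (\<beta> s) (\<beta> t)"
    by (rule tendsto_lowerbound) (use z(5) in auto)
  ultimately show False using e by simp
qed

text \<open>
  The contraction moves \<open>\<beta> t\<close> along the tree coded by \<open>h\<close> towards the root: at level \<open>c\<close> the
  ancestor of \<open>t\<close> is \<open>L c t\<close>.
\<close>

proposition tree_coded_loop_nullhomotopic: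
  fixes h :: "real \<Rightarrow> real" and \<beta> :: "real \<Rightarrow> 'a::real_normed_vector"
  assumes \<beta>: "path \<beta>" "path_image \<beta> \<subseteq> S" and h: "continuous_on {0..1} h" "h 0 = 0" "h 1 = 0"
    and nonneg: "\<And>t. t \<in> {0..1} \<Longrightarrow> 0 \<le> h t"
    and fact: "\<And>s t. 0 \<le> s \<Longrightarrow> s \<le> t \<Longrightarrow> t \<le> 1 \<Longrightarrow> h s = h t \<Longrightarrow>
                 \<forall>r\<in>{s..t}. h s \<le> h r \<Longrightarrow> \<beta> s = \<beta> t"
  shows "homotopic_loops S \<beta> (linepath (\<beta> 0) (\<beta> 0))"
proof -
  have c\<beta>: "continuous_on {0..1} \<beta>" using \<beta>(1) by (simp add: path_def)
  define P where "P c t s \<longleftrightarrow> s \<in> {0..t} \<and> h s = min c (h t) \<and> (\<forall>r\<in>{s..t}. min c (h t) \<le> h r)" for c t s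
  define L where "L c t = (SOME s. P c t s)" for c t
  have L: "P c t (L c t)" if c: "0 \<le> c" and t: "t \<in> {0..1}" for c t
  proof -
    have "\<exists>s. P c t s"
      using level_ancestor_exists[OF h(1,2) t, of "min c (h t)"] c nonneg[OF t]
      unfolding P_def by (metis min.cobounded2 min.boundedI)
    then show ?thesis unfolding L_def by (rule someI_ex)
  qed
  have L01: "L c t \<in> {0..1}" if "0 \<le> c" "t \<in> {0..1}" for c t
    using L[OF that] that by (auto simp: P_def)
  obtain M where M: "\<And>t. t \<in> {0..1} \<Longrightarrow> h t \<le> M"
  proof -
    have "compact (h ` {0..1})" using h(1) by (intro compact_continuous_image) auto
    then have "bdd_above (h ` {0..1})" by (intro bounded_imp_bdd_above compact_imp_bounded)
    then show ?thesis using that unfolding bdd_above_def by blast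
  qed
  have M0: "M \<ge> 0" using M[of 0] h(2) by simp
  define H where "H = (\<lambda>z. \<beta> (L (M * (1 - fst z)) (snd z)))"
  have contL: "continuous_on ({0..} \<times> {0..1}) (\<lambda>z::real \<times> real. \<beta> (L (fst z) (snd z)))"
    unfolding continuous_on_iff
  proof (intro ballI allI impI)
    fix z :: "real \<times> real" and e :: real assume z: "z \<in> {0..} \<times> {0..1::real}" and e: "e > 0"
    obtain d where d: "d > 0" and dd: "\<And>s t. 0 \<le> s \<Longrightarrow> s \<le> t \<Longrightarrow> t \<le> 1 \<Longrightarrow>
           (\<forall>r\<in>{s..t}. h s - d \<le> h r \<and> h t - d \<le> h r) \<Longrightarrow> dist (\<beta> s) (\<beta> t) < e"
      using tree_coded_path_modulus[OF c\<beta> h(1) _ e] fact by metis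
    have "uniformly_continuous_on {0..1} h" using h(1) by (intro compact_uniformly_continuous) auto
    then obtain \<eta> where \<eta>: "\<eta> > 0" "\<And>t t'. t \<in> {0..1} \<Longrightarrow> t' \<in> {0..1} \<Longrightarrow> \<bar>t' - t\<bar> < \<eta> \<Longrightarrow> \<bar>h t' - h t\<bar> < d/2"
      unfolding uniformly_continuous_on_def dist_real_def using d by (metis half_gt_zero)
    have key: "dist (\<beta> (L c t)) (\<beta> (L c' t')) < e"
      if c: "0 \<le> c" "0 \<le> c'" "\<bar>c - c'\<bar> < d/2" and t: "t \<in> {0..1}" "t' \<in> {0..1}" "\<bar>t' - t\<bar> < \<eta>"
        and le: "L c t \<le> L c' t'" for c c' t t'
    proof (rule dd)
      have 1: "P c t (L c t)" and 2: "P c' t' (L c' t')" using L c t by auto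
      have hh: "\<bar>h t' - h t\<bar> < d/2" using \<eta> t by blast
      have diff: "\<bar>h (L c t) - h (L c' t')\<bar> < d/2"
        using hh c(3) 1 2 unfolding P_def by linarith
      show "0 \<le> L c t" "L c' t' \<le> 1" using L01 c t by auto
      show "\<forall>r\<in>{L c t..L c' t'}. h (L c t) - d \<le> h r \<and> h (L c' t') - d \<le> h r"
      proof
        fix r assume r: "r \<in> {L c t..L c' t'}"
        have "h (L c t) - d/2 \<le> h r"
        proof (cases "r \<le> t")
          case True
          then have "h (L c t) \<le> h r" using r 1 unfolding P_def by auto
          then show ?thesis using d by simp
        next
          case False
          then have "\<bar>r - t\<bar> < \<eta>" "r \<in> {0..1}" using r 2 t unfolding P_def by auto
          then have "\<bar>h r - h t\<bar> < d/2" using \<eta> t by blast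
          moreover have "h (L c t) \<le> h t" using 1 unfolding P_def by auto
          ultimately show ?thesis by linarith
        qed
        then show "h (L c t) - d \<le> h r \<and> h (L c' t') - d \<le> h r" using diff d by linarith
      qed
    qed (rule le)
    show "\<exists>d>0. \<forall>z'\<in>{0..} \<times> {0..1}. dist z' z < d \<longrightarrow>
            dist (\<beta> (L (fst z') (snd z'))) (\<beta> (L (fst z) (snd z))) < e"
    proof (intro exI conjI ballI impI)
      show "min (d/2) \<eta> > 0" using d \<eta> by simp
      fix z' :: "real \<times> real" assume z': "z' \<in> {0..} \<times> {0..1::real}" and "dist z' z < min (d/2) \<eta>"
      then have *: "\<bar>fst z' - fst z\<bar> < d/2" "\<bar>snd z' - snd z\<bar> < \<eta>"
        using dist_fst_le[of z' z] dist_snd_le[of z' z] by (auto simp: dist_real_def)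
      show "dist (\<beta> (L (fst z') (snd z'))) (\<beta> (L (fst z) (snd z))) < e"
        using key[of "fst z" "fst z'" "snd z" "snd z'"] key[of "fst z'" "fst z" "snd z'" "snd z"] z z' *
        by (cases "L (fst z) (snd z) \<le> L (fst z') (snd z')") (auto simp: mem_Times_iff dist_commute abs_minus_commute)
    qed
  qed
  have contH: "continuous_on ({0..1} \<times> {0..1}) H"
  proof -
    have "continuous_on ({0..1} \<times> {0..1}) ((\<lambda>z. \<beta> (L (fst z) (snd z))) \<circ> (\<lambda>z. (M * (1 - fst z), snd z)))"
      by (intro continuous_on_compose continuous_intros continuous_on_subset[OF contL])
         (use M0 in \<open>auto simp: mem_Times_iff\<close>)
    then show ?thesis by (simp add: H_def o_def)
  qed
  have root: "\<beta> (L c t) = \<beta> 0" if t: "t \<in> {0..1}" and c: "0 \<le> c" and "min c (h t) = 0" for c t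
  proof -
    have l: "L c t \<in> {0..1}" "h (L c t) = 0" using L[OF c t] L01[OF c t] that(3) by (auto simp: P_def)
    show ?thesis using fact[of 0 "L c t"] l h(2) nonneg by auto
  qed
  show ?thesis
    unfolding homotopic_loops
  proof (intro exI conjI ballI)
    show "continuous_on ({0..1} \<times> {0..1}) H" by (rule contH)
    show "H \<in> {0..1} \<times> {0..1} \<rightarrow> S"
      using L01 M0 \<beta>(2) by (fastforce simp: H_def path_image_def)
    show "H (0, t) = \<beta> t" if t: "t \<in> {0..1}" for t
    proof -
      have "P M t (L M t)" using L M0 t by blast
      then show ?thesis using fact[of "L M t" t] M[OF t] t by (auto simp: H_def P_def min_absorb2)
    qed
    show "H (1, t) = linepath (\<beta> 0) (\<beta> 0) t" if t: "t \<in> {0..1}" for t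
      using root[of t 0] t nonneg[OF t] by (simp add: H_def linepath_refl)
    show "pathfinish (H \<circ> Pair t) = pathstart (H \<circ> Pair t)" if t: "t \<in> {0..1}" for t
      using root[of 0 "M * (1 - t)"] root[of 1 "M * (1 - t)"] M0 t h
      by (simp add: H_def pathfinish_def pathstart_def)
  qed
qed

section \<open>The tree of words\<close>

type_synonym letter = "int \<times> bool"

text \<open>
  Words grow at their head, so the ancestors of a vertex are its suffixes, and a nonempty word also
  names the edge joining it to its tail. A point of the tree is encoded by the function that
  says which part of each edge lies on the geodesic from the root to the point.
\<close>

definition vert :: "letter list \<Rightarrow> letter list \<Rightarrow> real" where
  "vert w v = (if v \<noteq> [] \<and> suffix v w then 1 else 0)"

definition edge_pt :: "letter list \<Rightarrow> letter \<Rightarrow> real \<Rightarrow> letter list \<Rightarrow> real" where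
  "edge_pt w l s = (vert w)(l # w := s)"

definition tree :: "(letter list \<Rightarrow> real) set" where
  "tree = {edge_pt w l s |w l s. 0 \<le> s \<and> s \<le> 1}"

lemma edge_pt_0: "edge_pt w l 0 = vert w"
  by (auto simp: edge_pt_def vert_def fun_eq_iff suffix_def)

lemma edge_pt_simps: "edge_pt w l s (l # w) = s" "v \<noteq> l # w \<Longrightarrow> edge_pt w l s v = vert w v"
  by (auto simp: edge_pt_def)

lemma vert_in_tree: "vert w \<in> tree"
  unfolding tree_def mem_Collect_eq using edge_pt_0[of w] by (metis order_refl zero_le_one)

lemma tree_bounds: "f \<in> tree \<Longrightarrow> 0 \<le> f v \<and> f v \<le> 1"
  by (auto simp: tree_def edge_pt_def vert_def)

lemma tree_supp:
  assumes "f \<in> tree" "f v > 0" obtains w l s where "f = edge_pt w l s" "0 \<le> s" "s \<le> 1" "suffix v (l # w)" "v \<noteq> []"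
  using assms by (auto simp: tree_def edge_pt_def vert_def suffix_Cons split: if_splits)

lemma tree_Nil: "f \<in> tree \<Longrightarrow> f [] = 0"
  by (auto simp: tree_def edge_pt_def vert_def)

lemma finite_suffixes: "finite {v. suffix v w}"
  using finite_set[of "suffixes w"] by (simp add: set_suffixes_eq)

lemma finite_tree_supp: assumes "f \<in> tree" shows "finite {v. f v \<noteq> 0}"
proof -
  obtain w l s where "f = edge_pt w l s" using assms by (auto simp: tree_def)
  then have "{v. f v \<noteq> 0} \<subseteq> {v. suffix v (l # w)}"
    by (auto simp: edge_pt_def vert_def suffix_Cons split: if_splits)
  then show ?thesis using finite_suffixes finite_subset by blast
qed

lemma tree_chain:
  assumes f: "f \<in> tree" and p: "f v > 0" "f v' > 0" and l: "length v \<le> length v'"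
  shows "suffix v v'"
proof -
  obtain w l s where "f = edge_pt w l s" "suffix v (l # w)" using tree_supp[OF f p(1)] by metis
  moreover from this have "suffix v' (l # w)" using p(2)
    by (auto simp: edge_pt_def vert_def suffix_Cons split: if_splits)
  ultimately show ?thesis using suffix_length_suffix l by blast
qed

lemma tree_below:
  assumes f: "f \<in> tree" and p: "f v' > 0" and v: "suffix v v'" "v \<noteq> v'" "v \<noteq> []"
  shows "f v = 1"
proof -
  obtain w l s where 1: "f = edge_pt w l s" "suffix v' (l # w)" using tree_supp[OF f p(1)] by metis
  have len: "length v < length v'" using v by (metis suffix_length_le le_neq_implies_less suffix_def append_eq_append_conv self_append_conv2)
  have "length v' \<le> length (l # w)" using 1 suffix_length_le by blast
  then have "v \<noteq> l # w" using len by auto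
  moreover have "suffix v (l # w)" using 1 v suffix_order.order_trans by blast
  ultimately show ?thesis using 1 v by (auto simp: edge_pt_def vert_def suffix_Cons)
qed

lemma tree_path_meet:
  fixes f :: "real \<Rightarrow> letter list \<Rightarrow> real"
  assumes tr: "\<And>r. r \<in> {s..t} \<Longrightarrow> f r \<in> tree"
    and cont: "\<And>v. continuous_on {s..t} (\<lambda>r. f r v)" and st: "s \<le> t"
  shows "\<exists>r\<in>{s..t}. \<forall>v. f r v \<le> min (f s v) (f t v)"
proof (cases "(\<forall>v. f s v \<le> f t v) \<or> (\<forall>v. f t v \<le> f s v)")
  case True
  then show ?thesis using st by (auto intro: bexI[of _ s] bexI[of _ t])
next
  case False
  have fs: "f s \<in> tree" and ft: "f t \<in> tree" using tr st by auto
  note bs = tree_bounds[OF fs] and bt = tree_bounds[OF ft]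
  have sub: "\<exists>l u. v = l # u \<and> (\<forall>x. suffix x u \<longrightarrow> x \<noteq> [] \<longrightarrow> g x = 1 \<and> g' x = 1)"
    if g: "g \<in> tree" "g' \<in> tree" and gt: "g v > g' v" and min: "\<And>x. length x < length v \<Longrightarrow> g x \<le> g' x"
    for g g' v
  proof -
    have "v \<noteq> []" using gt tree_Nil[OF g(1)] tree_Nil[OF g(2)] by auto
    then obtain l u where v: "v = l # u" by (cases v) auto
    have "g v > 0" using gt tree_bounds[OF g(2), of v] by linarith
    moreover have "g x = 1 \<and> g' x = 1" if x: "suffix x u" "x \<noteq> []" for x
    proof -
      have "length x < length v" using x v suffix_length_le by fastforce
      moreover from this have "x \<noteq> v" by auto
      then have "g x = 1" using tree_below[OF g(1) \<open>g v > 0\<close>, of x] x v by (simp add: suffix_Cons)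
      ultimately show ?thesis using min[of x] tree_bounds[OF g(2), of x] by linarith
    qed
    ultimately show ?thesis using v by blast
  qed
  obtain v1 where v1: "f s v1 > f t v1" "\<And>x. length x < length v1 \<Longrightarrow> f s x \<le> f t x"
    using False ex_has_least_nat[of "\<lambda>v. f s v > f t v" _ length] by (metis not_less)
  obtain v2 where v2: "f t v2 > f s v2" "\<And>x. length x < length v2 \<Longrightarrow> f t x \<le> f s x"
    using False ex_has_least_nat[of "\<lambda>v. f t v > f s v" _ length] by (metis not_less)
  obtain l u where u: "v1 = l # u" "\<And>x. suffix x u \<Longrightarrow> x \<noteq> [] \<Longrightarrow> f s x = 1 \<and> f t x = 1"
    using sub[OF fs ft v1] by blast
  obtain l' u' where u': "v2 = l' # u'" "\<And>x. suffix x u' \<Longrightarrow> x \<noteq> [] \<Longrightarrow> f s x = 1 \<and> f t x = 1"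
    using sub[OF ft fs v2] by blast
  have p1: "f s v1 > 0" and p2: "f t v2 > 0" using v1(1) v2(1) bs[of v2] bt[of v1] by linarith+
  have t0: "f t v1 = 0"
  proof (rule ccontr)
    assume "f t v1 \<noteq> 0"
    then have q: "f t v1 > 0" using bt[of v1] by linarith
    show False
    proof (cases "length v1 \<le> length v2")
      case True
      then have "suffix v1 v2" using tree_chain[OF ft q p2] by blast
      moreover have "v1 \<noteq> v2" using v1 v2 by auto
      ultimately show False using u' u(1) v1(1) by (auto simp: suffix_Cons)
    next
      case F: False
      then have "suffix v2 v1" using tree_chain[OF ft p2 q] by auto
      moreover have "v1 \<noteq> v2" using v1 v2 by auto
      ultimately show False using u u'(1) v2(1) by (auto simp: suffix_Cons)
    qed
  qed
  define Z where "Z = {r \<in> {s..t}. f r v1 = 0}"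
  have "closed Z" unfolding Z_def using continuous_closed_preimage_constant[OF cont] by simp
  have "Z \<noteq> {}" using t0 st by (auto simp: Z_def)
  have bd: "bdd_below Z" by (auto simp: Z_def)
  define r where "r = Inf Z"
  have r: "r \<in> Z" unfolding r_def using closed_contains_Inf[OF \<open>Z \<noteq> {}\<close> bd \<open>closed Z\<close>] .
  have before: "f x v1 > 0" if "s \<le> x" "x < r" for x
  proof -
    have "x \<notin> Z" using that cInf_lower[OF _ bd] unfolding r_def by force
    then show ?thesis using that r tree_bounds[OF tr, of x v1] by (auto simp: Z_def less_le)
  qed
  have sr: "s < r" using r p1 by (auto simp: Z_def less_le)
  have fr: "f r \<in> tree" using r tr by (auto simp: Z_def)
  have "f r v \<le> f s v \<and> f r v \<le> f t v" for v
  proof (cases "suffix v u \<and> v \<noteq> []")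
    case True
    then show ?thesis using u(2) tree_bounds[OF fr] by simp
  next
    case False
    have "f r v = 0"
    proof (rule ccontr)
      assume nz: "f r v \<noteq> 0"
      then have pos: "f r v > 0" using tree_bounds[OF fr, of v] by linarith
      have "((\<lambda>x. f x v) \<longlongrightarrow> f r v) (at r within {s..t})"
        using cont[of v] r by (auto simp: continuous_on_def Z_def)
      then have "\<forall>\<^sub>F x in at r within {s..t}. f x v > 0" using pos order_tendstoD by fast
      then obtain d where d: "d > 0" "\<And>x. x \<in> {s..t} \<Longrightarrow> x \<noteq> r \<Longrightarrow> dist x r < d \<Longrightarrow> f x v > 0"
        unfolding eventually_at by blast
      define x where "x = max s (r - d/2)"
      have x: "s \<le> x" "x < r" "x \<in> {s..t}" "dist x r < d"
        using sr d(1) r by (auto simp: x_def Z_def dist_real_def)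
      have xv: "f x v > 0" "f x v1 > 0" using d(2)[of x] x before by auto
      have "v \<noteq> v1" using r nz by (auto simp: Z_def)
      show False
      proof (cases "length v \<le> length v1")
        case True
        then have "suffix v v1" using tree_chain[OF tr[OF x(3)] xv] by blast
        moreover have "v \<noteq> []" using nz tree_Nil[OF fr] by auto
        ultimately show False using False u(1) \<open>v \<noteq> v1\<close> by (auto simp: suffix_Cons)
      next
        case F: False
        then have "suffix v1 v" using tree_chain[OF tr[OF x(3)] xv(2,1)] by auto
        then have "f r v1 = 1" using tree_below[OF fr pos] u(1) \<open>v \<noteq> v1\<close> by auto
        then show False using r by (auto simp: Z_def)
      qed
    qed
    then show ?thesis using bs bt by simp
  qed
  then show ?thesis using r by (auto simp: Z_def intro!: bexI[of _ r])
qed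

definition word_dist :: "(int \<Rightarrow> real) \<Rightarrow> (letter list \<Rightarrow> real) \<Rightarrow> (letter list \<Rightarrow> real) \<Rightarrow> real" where
  "word_dist \<omega> f g = (\<Sum>v\<in>{v. f v \<noteq> g v}. \<omega> (fst (hd v)) * \<bar>f v - g v\<bar>)"

lemma word_dist_eq_sum:
  assumes "finite V" "{v. f v \<noteq> g v} \<subseteq> V"
  shows "word_dist \<omega> f g = (\<Sum>v\<in>V. \<omega> (fst (hd v)) * \<bar>f v - g v\<bar>)"
  unfolding word_dist_def by (rule sum.mono_neutral_left) (use assms in auto)

lemma finite_tree_diff:
  assumes "f \<in> tree" "g \<in> tree" shows "finite {v. f v \<noteq> g v}"
  by (rule finite_subset[OF _ finite_UnI[OF finite_tree_supp[OF assms(1)] finite_tree_supp[OF assms(2)]]]) auto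

lemma word_dist_nonneg: "(\<And>n. 0 \<le> \<omega> n) \<Longrightarrow> 0 \<le> word_dist \<omega> f g"
  unfolding word_dist_def by (intro sum_nonneg) auto

lemma word_dist_triangle:
  assumes "f \<in> tree" "g \<in> tree" "h \<in> tree" "\<And>n. 0 \<le> \<omega> n"
  shows "word_dist \<omega> f h \<le> word_dist \<omega> f g + word_dist \<omega> g h"
proof -
  define V where "V = {v. f v \<noteq> g v} \<union> {v. g v \<noteq> h v} \<union> {v. f v \<noteq> h v}"
  have V: "finite V" "{v. f v \<noteq> g v} \<subseteq> V" "{v. g v \<noteq> h v} \<subseteq> V" "{v. f v \<noteq> h v} \<subseteq> V"
    using assms finite_tree_diff by (auto simp: V_def)
  show ?thesis
    unfolding word_dist_eq_sum[OF V(1,2)] word_dist_eq_sum[OF V(1,3)] word_dist_eq_sum[OF V(1,4)]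
      sum.distrib[symmetric] distrib_left[symmetric]
    by (intro sum_mono mult_left_mono) (use assms(4) in auto)
qed

lemma word_dist_commute: "word_dist \<omega> f g = word_dist \<omega> g f"
  unfolding word_dist_def by (rule sum.cong) (auto simp: abs_minus_commute)

lemma word_dist_ge:
  assumes "f \<in> tree" "g \<in> tree" "\<And>n. 0 \<le> \<omega> n"
  shows "\<omega> (fst (hd v)) * \<bar>f v - g v\<bar> \<le> word_dist \<omega> f g"
proof (cases "f v = g v")
  case True
  then show ?thesis using word_dist_nonneg assms by simp
next
  case False
  then show ?thesis unfolding word_dist_def
    using member_le_sum[of v "{v. f v \<noteq> g v}" "\<lambda>v. \<omega> (fst (hd v)) * \<bar>f v - g v\<bar>"] finite_tree_diff assms
    by auto
qed

definition height :: "(int \<Rightarrow> real) \<Rightarrow> (letter list \<Rightarrow> real) \<Rightarrow> real" where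
  "height \<omega> f = word_dist \<omega> f (vert [])"

lemma vert_Nil: "vert [] = (\<lambda>_. 0)"
  by (auto simp: vert_def fun_eq_iff)

lemma height_meet:
  assumes f: "f \<in> tree" "g \<in> tree" "m \<in> tree" and le: "\<And>v. m v \<le> min (f v) (g v)" and w: "\<And>n. 0 \<le> \<omega> n"
  shows "word_dist \<omega> f g \<le> height \<omega> f + height \<omega> g - 2 * height \<omega> m"
proof -
  define V where "V = {v. f v \<noteq> 0} \<union> {v. g v \<noteq> 0} \<union> {v. m v \<noteq> 0}"
  have V: "finite V" "{v. f v \<noteq> g v} \<subseteq> V" "{v. f v \<noteq> vert [] v} \<subseteq> V" "{v. g v \<noteq> vert [] v} \<subseteq> V" "{v. m v \<noteq> vert [] v} \<subseteq> V"
    using assms finite_tree_supp by (auto simp: V_def vert_Nil)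
  have "2 * height \<omega> m + word_dist \<omega> f g \<le> height \<omega> f + height \<omega> g"
    unfolding height_def word_dist_eq_sum[OF V(1,2)] word_dist_eq_sum[OF V(1,3)] word_dist_eq_sum[OF V(1,4)]
      word_dist_eq_sum[OF V(1,5)] sum.distrib[symmetric] sum_distrib_left
  proof (rule sum_mono)
    fix v assume "v \<in> V"
    have "2 * m v + \<bar>f v - g v\<bar> \<le> f v + g v" using le[of v] by auto
    from mult_left_mono[OF this w[of "fst (hd v)"]]
    show "2 * (\<omega> (fst (hd v)) * \<bar>m v - vert [] v\<bar>) + \<omega> (fst (hd v)) * \<bar>f v - g v\<bar>
        \<le> \<omega> (fst (hd v)) * \<bar>f v - vert [] v\<bar> + \<omega> (fst (hd v)) * \<bar>g v - vert [] v\<bar>"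
      using tree_bounds[OF f(1), of v] tree_bounds[OF f(2), of v] tree_bounds[OF f(3), of v]
      by (simp add: vert_Nil algebra_simps)
  qed
  then show ?thesis by simp
qed

lemma height_diff_le:
  assumes "f \<in> tree" "g \<in> tree" "\<And>n. 0 \<le> \<omega> n"
  shows "\<bar>height \<omega> f - height \<omega> g\<bar> \<le> word_dist \<omega> f g"
proof -
  have "word_dist \<omega> f (vert []) \<le> word_dist \<omega> f g + word_dist \<omega> g (vert [])"
    "word_dist \<omega> g (vert []) \<le> word_dist \<omega> g f + word_dist \<omega> f (vert [])"
    by (intro word_dist_triangle assms vert_in_tree)+
  then show ?thesis by (simp add: height_def word_dist_commute[of \<omega> g f])
qed

definition letter_dist :: "int \<Rightarrow> (letter list \<Rightarrow> real) \<Rightarrow> (letter list \<Rightarrow> real) \<Rightarrow> real" where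
  "letter_dist n = word_dist (\<lambda>m. if m = n then 1 else 0)"

lemma word_dist_eq_sum_letter_dist:
  assumes "f \<in> tree" "g \<in> tree"
  shows "word_dist \<omega> f g = (\<Sum>n\<in>(\<lambda>v. fst (hd v)) ` {v. f v \<noteq> g v}. \<omega> n * letter_dist n f g)"
proof -
  let ?V = "{v. f v \<noteq> g v}" and ?k = "\<lambda>v. fst (hd v) :: int"
  have fin: "finite ?V" using finite_tree_diff assms by blast
  have "letter_dist n f g = (\<Sum>v\<in>{v\<in>?V. ?k v = n}. \<bar>f v - g v\<bar>)" for n
    unfolding letter_dist_def word_dist_def
    by (rule sum.mono_neutral_cong_right) (use fin in auto)
  then have "(\<Sum>n\<in>?k ` ?V. \<omega> n * letter_dist n f g) = (\<Sum>n\<in>?k ` ?V. \<Sum>v\<in>{v\<in>?V. ?k v = n}. \<omega> (?k v) * \<bar>f v - g v\<bar>)"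
    by (intro sum.cong) (auto simp: sum_distrib_left intro!: sum.cong)
  also have "\<dots> = word_dist \<omega> f g"
    unfolding word_dist_def using sum.image_gen[OF fin, of "\<lambda>v. \<omega> (?k v) * \<bar>f v - g v\<bar>" ?k] by simp
  finally show ?thesis by simp
qed

lemma letter_dist_le:
  assumes "f \<in> tree" "g \<in> tree" "\<And>u. u \<noteq> v \<Longrightarrow> fst (hd u) = n \<Longrightarrow> f u = g u" "\<bar>f v - g v\<bar> \<le> e"
  shows "letter_dist n f g \<le> e"
proof -
  let ?V = "{v. f v \<noteq> g v}"
  have fin: "finite (insert v ?V)" using finite_tree_diff assms by blast
  have "letter_dist n f g = (\<Sum>u\<in>insert v ?V. (if fst (hd u) = n then 1 else 0) * \<bar>f u - g u\<bar>)"
    unfolding letter_dist_def by (rule word_dist_eq_sum) (use fin in auto)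
  also have "\<dots> = (\<Sum>u\<in>{v}. (if fst (hd u) = n then 1 else 0) * \<bar>f u - g u\<bar>)"
    by (rule sum.mono_neutral_right) (use fin assms(3) in auto)
  also have "\<dots> \<le> e" using assms(4) abs_ge_zero[of "f v - g v"] by auto
  finally show ?thesis .
qed

section \<open>A Euclidean model of the telescope and its tree coverings\<close>

type_synonym model_point = "real \<times> real \<times> real"

text \<open>
  At height \<open>u\<close> the circle \<open>c\<^sub>n\<close> is given radius \<open>1 / (n + u)\<close>, so the slice at an integer height
  \<open>i\<close> is the earring \<open>X\<^sub>i\<close> with \<open>c\<^sub>n = C\<^bsub>n + i\<^esub>\<close>. Off the axis \<open>p = 0\<close> (and only there), \<open>circ\<close> is the
  number of the circle through a point and \<open>ang\<close> runs from \<open>0\<close> to \<open>1\<close> along it.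
\<close>

definition model :: "model_point set" where
  "model = {(u, p). \<exists>n::int. 1 \<le> of_int n + u \<and> (of_int n + u) * (norm p)\<^sup>2 = 2 * fst p}"

definition circ :: "model_point \<Rightarrow> int" where
  "circ z = \<lfloor>2 * fst (snd z) / (norm (snd z))\<^sup>2 - fst z\<rfloor>"

definition ang :: "model_point \<Rightarrow> real" where
  "ang z = (1 - snd (snd z) / norm (snd z)) / 2"

lemma model_off_axis:
  fixes z :: model_point
  assumes z: "z \<in> model" "snd z \<noteq> 0"
  shows "1 \<le> of_int (circ z) + fst z" "(of_int (circ z) + fst z) * (norm (snd z))\<^sup>2 = 2 * fst (snd z)"
    "of_int (circ z) = 2 * fst (snd z) / (norm (snd z))\<^sup>2 - fst z"
    "fst (snd z) > 0" "0 < ang z" "ang z < 1"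
    "ang z * (1 - ang z) = ((of_int (circ z) + fst z) * norm (snd z))\<^sup>2 / 16"
proof -
  define x y N where "x = fst (snd z)" and "y = snd (snd z)" and "N = norm (snd z)"
  have N: "N > 0" using z by (simp add: N_def)
  have N2: "N\<^sup>2 = x\<^sup>2 + y\<^sup>2"
    by (simp add: N_def x_def y_def norm_prod_def)
  obtain n :: int where n: "1 \<le> of_int n + fst z" "(of_int n + fst z) * N\<^sup>2 = 2 * x"
    using z(1) by (auto simp: model_def N_def x_def)
  have e: "of_int n = 2 * x / N\<^sup>2 - fst z" using n N by (simp add: field_simps)
  have c: "circ z = n" unfolding circ_def x_def[symmetric] N_def[symmetric] e[symmetric] by simp
  show "1 \<le> of_int (circ z) + fst z" "(of_int (circ z) + fst z) * (norm (snd z))\<^sup>2 = 2 * fst (snd z)"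
    "of_int (circ z) = 2 * fst (snd z) / (norm (snd z))\<^sup>2 - fst z"
    using n e c by (auto simp: x_def N_def)
  have "x > 0" using n N by (metis mult_pos_pos zero_less_power zero_less_one less_le_trans zero_less_mult_pos zero_less_numeral)
  then show "fst (snd z) > 0" by (simp add: x_def)
  have "\<bar>y\<bar> < N" using N2 \<open>x > 0\<close> N by (metis abs_of_pos abs_square_less_1 less_add_same_cancel2 power2_less_imp_less power2_abs zero_less_power less_imp_le)
  then show "0 < ang z" "ang z < 1" using N by (auto simp: ang_def y_def[symmetric] N_def[symmetric] field_simps)
  have "(1 - t) / 2 * (1 - (1 - t) / 2) = (1 - t\<^sup>2) / 4" for t :: real
    by (simp add: power2_eq_square field_simps)
  then have "ang z * (1 - ang z) = (1 - (y/N)\<^sup>2) / 4"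
    by (simp only: ang_def y_def N_def)
  also have "1 - (y/N)\<^sup>2 = (x/N)\<^sup>2"
  proof -
    have "(x/N)\<^sup>2 + (y/N)\<^sup>2 = N\<^sup>2 / N\<^sup>2"
      by (simp only: power_divide add_divide_distrib[symmetric] N2[symmetric])
    then show ?thesis using N by simp
  qed
  also have "x / N = (of_int (circ z) + fst z) * N / 2" using n c N by (simp add: field_simps power2_eq_square)
  finally show "ang z * (1 - ang z) = ((of_int (circ z) + fst z) * norm (snd z))\<^sup>2 / 16"
    by (simp add: N_def power_divide)
qed

lemma ang_isCont: "snd z \<noteq> 0 \<Longrightarrow> isCont ang z"
  unfolding ang_def by (intro continuous_intros) auto

lemma circ_locally_constant:
  assumes z: "z \<in> model" "snd z \<noteq> 0"
  shows "\<exists>d>0. \<forall>z'\<in>model. dist z' z < d \<longrightarrow> snd z' \<noteq> 0 \<and> circ z' = circ z"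
proof -
  define F where "F z = 2 * fst (snd z) / (norm (snd z))\<^sup>2 - fst z" for z :: model_point
  have "isCont F z" unfolding F_def using z by (intro continuous_intros) auto
  then obtain d1 where d1: "d1 > 0" "\<And>z'. dist z' z < d1 \<Longrightarrow> dist (F z') (F z) < 1"
    unfolding continuous_at_eps_delta by (metis zero_less_one)
  show ?thesis
  proof (intro exI conjI ballI impI)
    show "min d1 (norm (snd z)) > 0" using d1 z by simp
    fix z' assume z': "z' \<in> model" "dist z' z < min d1 (norm (snd z))"
    show nz: "snd z' \<noteq> 0"
      using dist_snd_le[of z' z] z' by (auto simp: dist_norm)
    have "of_int (circ z) = F z" "of_int (circ z') = F z'" using model_off_axis(3) z z' nz by (auto simp: F_def)
    then show "circ z' = circ z" using d1(2)[of z'] z' by (auto simp: dist_real_def)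
  qed
qed

definition trivial_at :: "int \<Rightarrow> model_point \<Rightarrow> bool" where
  "trivial_at k z \<longleftrightarrow> snd z = 0 \<or> k < circ z"

fun reduced_word :: "letter list \<Rightarrow> bool" where
  "reduced_word [] = True"
| "reduced_word (l # w) = (reduced_word w \<and> (w \<noteq> [] \<longrightarrow> hd w \<noteq> (fst l, \<not> snd l)))"

text \<open>
  Letters \<open>n > k\<close> may occur in the words as well; this only replaces the intended covering by a
  disjoint union of copies of it.
\<close>

definition fiber :: "int \<Rightarrow> model_point \<Rightarrow> (letter list \<Rightarrow> real) set" where
  "fiber k z = (if trivial_at k z then vert ` Collect reduced_word
     else {edge_pt w (circ z, b) (if b then ang z else 1 - ang z) |w b. reduced_word ((circ z, b) # w)})"

text \<open>
  Once all unwrapped circles are cut at the position \<open>c\<close>, the covering falls apart into the stars of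
  the vertices \<open>w\<close>. Two different cuts \<open>c\<close> suffice to cover the model by evenly covered sets.
\<close>

definition sheet :: "int \<Rightarrow> real \<Rightarrow> letter list \<Rightarrow> model_point \<Rightarrow> letter list \<Rightarrow> real" where
  "sheet k c w z =
     (if trivial_at k z then vert w
      else if ang z < c then
        (if w \<noteq> [] \<and> hd w = (circ z, False) then edge_pt (tl w) (circ z, False) (1 - ang z)
         else edge_pt w (circ z, True) (ang z))
      else
        (if w \<noteq> [] \<and> hd w = (circ z, True) then edge_pt (tl w) (circ z, True) (ang z)
         else edge_pt w (circ z, False) (1 - ang z)))"

definition cut_model :: "int \<Rightarrow> real \<Rightarrow> model_point set" where
  "cut_model k c = {z \<in> model. trivial_at k z \<or> ang z \<noteq> c}"

lemma ang_bounds: "z \<in> model \<Longrightarrow> \<not> trivial_at k z \<Longrightarrow> 0 < ang z \<and> ang z < 1"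
  using model_off_axis by (auto simp: trivial_at_def)

lemma fiber_subset_tree: "z \<in> model \<Longrightarrow> fiber k z \<subseteq> tree"
proof
  fix f assume z: "z \<in> model" and f: "f \<in> fiber k z"
  show "f \<in> tree"
  proof (cases "trivial_at k z")
    case True
    then show ?thesis using f vert_in_tree by (auto simp: fiber_def)
  next
    case False
    then obtain w b where "f = edge_pt w (circ z, b) (if b then ang z else 1 - ang z)"
      using f by (auto simp: fiber_def)
    moreover have "0 \<le> (if b then ang z else 1 - ang z)" "(if b then ang z else 1 - ang z) \<le> 1"
      using ang_bounds[OF z False] by auto
    ultimately show ?thesis unfolding tree_def mem_Collect_eq by blast
  qed
qed

lemma sheet_in_fiber: "reduced_word w \<Longrightarrow> sheet k c w z \<in> fiber k z"
proof -
  assume r: "reduced_word w"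
  show ?thesis
  proof (cases "trivial_at k z")
    case True
    then show ?thesis using r by (simp add: sheet_def fiber_def)
  next
    case False
    have F: "edge_pt v (circ z, b) (if b then ang z else 1 - ang z) \<in> fiber k z"
      if "reduced_word ((circ z, b) # v)" for v b
    proof -
      have "fiber k z = {edge_pt w (circ z, b) (if b then ang z else 1 - ang z) |w b. reduced_word ((circ z, b) # w)}"
        using False by (simp only: fiber_def if_False)
      then show ?thesis using that by blast
    qed
    show ?thesis
    proof (cases "w \<noteq> [] \<and> hd w = (circ z, \<not> ang z < c)")
      case True
      then have "w = (circ z, \<not> ang z < c) # tl w" by (metis list.collapse)
      then have "reduced_word ((circ z, \<not> ang z < c) # tl w)" using r by metis
      then show ?thesis using F[of "\<not> ang z < c" "tl w"] True False by (cases "ang z < c") (simp_all add: sheet_def)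
    next
      case nh: False
      then have "reduced_word ((circ z, ang z < c) # w)" using r by auto
      then show ?thesis using F[of "ang z < c" w] nh False by (auto simp: sheet_def)
    qed
  qed
qed

lemma fiber_eq_sheets:
  assumes z: "z \<in> cut_model k c"
  shows "fiber k z = (\<lambda>w. sheet k c w z) ` Collect reduced_word"
proof (intro equalityI subsetI)
  fix f assume f: "f \<in> fiber k z"
  show "f \<in> (\<lambda>w. sheet k c w z) ` Collect reduced_word"
  proof (cases "trivial_at k z")
    case True
    then show ?thesis using f by (auto simp: fiber_def sheet_def)
  next
    case False
    then obtain w b where w: "reduced_word ((circ z, b) # w)" "f = edge_pt w (circ z, b) (if b then ang z else 1 - ang z)"
      using f by (auto simp: fiber_def)
    have "ang z \<noteq> c" using z False by (auto simp: cut_model_def)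
    show ?thesis
    proof (cases "b = (ang z < c)")
      case True
      then have "f = sheet k c w z" using w False by (auto simp: sheet_def)
      then show ?thesis using w by auto
    next
      case nb: False
      then have "f = sheet k c ((circ z, b) # w) z" using w False by (auto simp: sheet_def)
      then show ?thesis using w(1) by blast
    qed
  qed
next
  fix f assume "f \<in> (\<lambda>w. sheet k c w z) ` Collect reduced_word"
  then show "f \<in> fiber k z" using sheet_in_fiber by (metis (no_types, lifting) imageE mem_Collect_eq)
qed

definition threshold :: "real \<Rightarrow> letter list \<Rightarrow> real" where
  "threshold c v = (if snd (hd v) then c else 1 - c)"

lemma edge_pt_alt: "edge_pt w l s = (vert (l # w))(l # w := s)"
  by (auto simp: edge_pt_def vert_def fun_eq_iff suffix_Cons)

lemma sheet_eq_update:
  assumes "z \<in> cut_model k c" "\<not> trivial_at k z"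
  shows "\<exists>x s. x \<noteq> [] \<and> sheet k c w z = (vert w)(x := s) \<and>
           (if suffix x w then s = threshold c x + \<bar>ang z - c\<bar> else s = threshold c x - \<bar>ang z - c\<bar>) \<and>
           \<bar>s - vert w x\<bar> = \<bar>if ang z < c then ang z else 1 - ang z\<bar>"
proof -
  have nsuf: "\<not> suffix (l # w) w" for l using suffix_length_le by fastforce
  show ?thesis
  proof (cases "w \<noteq> [] \<and> hd w = (circ z, \<not> ang z < c)")
    case True
    define s where "s = (if ang z < c then 1 - ang z else ang z)"
    have w: "w = (circ z, \<not> ang z < c) # tl w" using True by (metis list.collapse)
    have "sheet k c w z = edge_pt (tl w) (circ z, \<not> ang z < c) s"
      using assms(2) True by (simp add: sheet_def s_def)
    also have "\<dots> = (vert w)(w := s)" using w by (simp add: edge_pt_alt)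
    finally show ?thesis using True
      by (intro exI[of _ w] exI[of _ s]) (auto simp: s_def threshold_def vert_def)
  next
    case False
    define s where "s = (if ang z < c then ang z else 1 - ang z)"
    let ?l = "(circ z, ang z < c)"
    have "sheet k c w z = edge_pt w ?l s"
      using assms(2) False by (auto simp: sheet_def s_def)
    then show ?thesis using nsuf
      by (intro exI[of _ "?l # w"] exI[of _ s]) (auto simp: s_def threshold_def vert_def edge_pt_def)
  qed
qed

lemma sheet_threshold:
  assumes z: "z \<in> cut_model k c" and c: "0 < c" "c < 1"
  shows "\<exists>d>0. \<forall>w v. v \<noteq> [] \<longrightarrow> (if suffix v w then threshold c v + d \<le> sheet k c w z v
                                          else sheet k c w z v \<le> threshold c v - d)"
proof -
  define d where "d = min (min c (1 - c)) (if trivial_at k z then 1 else \<bar>ang z - c\<bar>)"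
  have "d > 0" using z c by (auto simp: d_def cut_model_def)
  moreover have "if suffix v w then threshold c v + d \<le> sheet k c w z v
                                          else sheet k c w z v \<le> threshold c v - d"
    if v: "v \<noteq> []" for w v
  proof -
    have d: "d \<le> c" "d \<le> 1 - c" "\<not> trivial_at k z \<Longrightarrow> d \<le> \<bar>ang z - c\<bar>" by (auto simp: d_def)
    have vw: "if suffix v w then threshold c v + d \<le> vert w v else vert w v \<le> threshold c v - d"
      using v d(1,2) by (auto simp: threshold_def vert_def)
    show ?thesis
    proof (cases "trivial_at k z")
      case True then show ?thesis using vw by (simp add: sheet_def)
    next
      case False
      obtain x s where "sheet k c w z = (vert w)(x := s)"
        "if suffix x w then s = threshold c x + \<bar>ang z - c\<bar> else s = threshold c x - \<bar>ang z - c\<bar>"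
        using sheet_eq_update[OF z False] by metis
      then show ?thesis using vw d(3)[OF False] by (cases "v = x") (auto split: if_splits)
    qed
  qed
  ultimately show ?thesis by blast
qed

lemma sheet_separation:
  assumes z: "z \<in> cut_model k c" and c: "0 < c" "c < 1"
  shows "\<exists>d>0. \<forall>z'\<in>cut_model k c. \<forall>w w'. (\<forall>v. \<bar>sheet k c w' z' v - sheet k c w z v\<bar> < d) \<longrightarrow> w' = w"
proof -
  obtain d where d: "d > 0" "\<And>w v. v \<noteq> [] \<Longrightarrow> (if suffix v w then threshold c v + d \<le> sheet k c w z v
                                          else sheet k c w z v \<le> threshold c v - d)"
    using sheet_threshold[OF assms] by blast
  have "w' = w" if z': "z' \<in> cut_model k c" and close: "\<And>v. \<bar>sheet k c w' z' v - sheet k c w z v\<bar> < d" for z' w w'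
  proof -
    obtain d' where d': "d' > 0" "\<And>w v. v \<noteq> [] \<Longrightarrow> (if suffix v w then threshold c v + d' \<le> sheet k c w z' v
                                          else sheet k c w z' v \<le> threshold c v - d')"
      using sheet_threshold[OF z' c] by blast
    have "suffix v w' \<longleftrightarrow> suffix v w" if "v \<noteq> []" for v
      using close[of v] d(2)[OF that, of w] d'(2)[OF that, of w'] d(1) d'(1) by (auto split: if_splits)
    then show ?thesis by (metis suffix_order.antisym suffix_order.refl Nil_suffix)
  qed
  then show ?thesis using d(1) by blast
qed

lemma sheet_minus_vert:
  assumes "z \<in> cut_model k c" "\<not> trivial_at k z"
  shows "\<bar>sheet k c w z v - vert w v\<bar> \<le> \<bar>if ang z < c then ang z else 1 - ang z\<bar>"
proof -
  obtain x s where "sheet k c w z = (vert w)(x := s)"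
    "\<bar>s - vert w x\<bar> = \<bar>if ang z < c then ang z else 1 - ang z\<bar>"
    using sheet_eq_update[OF assms] by metis
  then show ?thesis by (cases "v = x") auto
qed

lemma sheet_near:
  assumes z: "z \<in> cut_model k c" and c: "0 < c" "c < 1" and e: "e > 0"
  shows "\<exists>d>0. \<forall>z'\<in>model. dist z' z < d \<longrightarrow>
           z' \<in> cut_model k c \<and> (\<forall>w v. \<bar>sheet k c w z' v - sheet k c w z v\<bar> \<le> e)"
proof (cases "snd z = 0")
  case False
  have zm: "z \<in> model" using z by (simp add: cut_model_def)
  obtain d1 where d1: "d1 > 0" "\<And>z'. z' \<in> model \<Longrightarrow> dist z' z < d1 \<Longrightarrow> snd z' \<noteq> 0 \<and> circ z' = circ z"
    using circ_locally_constant[OF zm False] by blast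
  show ?thesis
  proof (cases "k < circ z")
    case True
    have "sheet k c w z' v = sheet k c w z v" "z' \<in> cut_model k c" if "z' \<in> model" "dist z' z < d1" for z' w v
      using d1(2)[OF that] True that by (auto simp: sheet_def trivial_at_def cut_model_def)
    then show ?thesis using d1(1) e by (intro exI[of _ d1]) auto
  next
    case nk: False
    define e' where "e' = min e \<bar>ang z - c\<bar>"
    have nt: "\<not> trivial_at k z" using False nk by (simp add: trivial_at_def)
    then have "e' > 0" using e z by (auto simp: e'_def cut_model_def)
    then obtain d2 where d2: "d2 > 0" "\<And>z'. dist z' z < d2 \<Longrightarrow> \<bar>ang z' - ang z\<bar> < e'"
      using ang_isCont[OF False] unfolding continuous_at_eps_delta dist_real_def by metis
    have "z' \<in> cut_model k c \<and> (\<forall>w v. \<bar>sheet k c w z' v - sheet k c w z v\<bar> \<le> e)"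
      if z': "z' \<in> model" "dist z' z < min d1 d2" for z'
    proof -
      have 1: "snd z' \<noteq> 0" "circ z' = circ z" using d1(2) z' by auto
      have 2: "\<bar>ang z' - ang z\<bar> < e" "\<bar>ang z' - ang z\<bar> < \<bar>ang z - c\<bar>" using d2(2)[of z'] z' by (auto simp: e'_def)
      then have 3: "ang z' < c \<longleftrightarrow> ang z < c" "ang z' \<noteq> c" by auto
      have "\<not> trivial_at k z'" using 1 nk by (simp add: trivial_at_def)
      then show ?thesis using 1 2 3 nt e z' by (auto simp: sheet_def cut_model_def edge_pt_def)
    qed
    then show ?thesis using d1(1) d2(1) by (intro exI[of _ "min d1 d2"]) auto
  qed
next
  case True
  define B where "B = \<bar>real_of_int k\<bar> + \<bar>fst z\<bar> + 1"
  define m where "m = min c (1 - c)"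
  have B: "B > 0" by (simp add: B_def)
  have m: "m > 0" "m \<le> c" "m \<le> 1 - c" using c by (auto simp: m_def)
  define q where "q = min (m * m) (min (m * e) 1)"
  have q: "q > 0" "q \<le> m * m" "q \<le> m * e" "q \<le> 1" using m e by (auto simp: q_def)
  define d where "d = min 1 (q / B)"
  have d: "d > 0" "d \<le> 1" "d \<le> q / B" using q B by (auto simp: d_def)
  have "z' \<in> cut_model k c \<and> (\<forall>w v. \<bar>sheet k c w z' v - sheet k c w z v\<bar> \<le> e)"
    if z': "z' \<in> model" "dist z' z < d" for z'
  proof (cases "trivial_at k z'")
    case True
    then show ?thesis using \<open>snd z = 0\<close> e z' by (auto simp: cut_model_def sheet_def trivial_at_def)
  next
    case False
    then have nz: "snd z' \<noteq> 0" and "circ z' \<le> k" by (auto simp: trivial_at_def)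
    have "\<bar>fst z' - fst z\<bar> < 1" "norm (snd z') < d"
      using dist_fst_le[of z' z] dist_snd_le[of z' z] z' \<open>snd z = 0\<close> d by (auto simp: dist_real_def)
    then have "of_int (circ z') + fst z' \<le> B" using \<open>circ z' \<le> k\<close> unfolding B_def by linarith
    have "(of_int (circ z') + fst z') * norm (snd z') \<le> B * (q / B)"
      using \<open>of_int (circ z') + fst z' \<le> B\<close> \<open>norm (snd z') < d\<close> d B by (intro mult_mono) auto
    then have le: "(of_int (circ z') + fst z') * norm (snd z') \<le> q" using B by simp
    have nn: "0 \<le> (of_int (circ z') + fst z') * norm (snd z')" using model_off_axis(1)[OF z'(1) nz] by simp
    have "((of_int (circ z') + fst z') * norm (snd z'))\<^sup>2 / 16 \<le> q\<^sup>2 / 16"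
      using power_mono[OF le nn, of 2] by simp
    also have "\<dots> < q" using q(1,4) mult_left_mono[OF q(4), of q] by (simp add: power2_eq_square)
    finally have pq: "ang z' * (1 - ang z') < q" unfolding model_off_axis(7)[OF z'(1) nz] .
    have a: "0 < ang z'" "ang z' < 1" using ang_bounds[OF z'(1) False] by auto
    have small: "(if ang z' < c then ang z' else 1 - ang z') * m \<le> ang z' * (1 - ang z')"
      using a m by (auto intro: mult_left_mono mult_mono simp: mult.commute)
    then have "(if ang z' < c then ang z' else 1 - ang z') * m < e * m" using pq q(3) by (simp add: mult.commute)
    then have le_e: "(if ang z' < c then ang z' else 1 - ang z') < e" using m(1) by (metis mult_less_cancel_right_pos)
    have "ang z' \<noteq> c"
    proof
      assume "ang z' = c"
      then have "c * (1 - c) < m * m" using pq q by simp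
      moreover have "m * m \<le> c * (1 - c)" using m by (intro mult_mono) auto
      ultimately show False by simp
    qed
    then have zc: "z' \<in> cut_model k c" using z'(1) by (simp add: cut_model_def)
    moreover have "sheet k c w z v = vert w v" for w v using \<open>snd z = 0\<close> by (simp add: sheet_def trivial_at_def)
    moreover have "\<bar>sheet k c w z' v - vert w v\<bar> \<le> e" for w v
      using sheet_minus_vert[OF zc False, of w v] le_e a by (auto split: if_splits)
    ultimately show ?thesis by simp
  qed
  then show ?thesis using d(1) by blast
qed

text \<open>The lifting theorems for covering spaces require the total space to lie in a normed space.\<close>

definition emb :: "(letter list \<Rightarrow> real) \<Rightarrow> nat \<Rightarrow>\<^sub>C real" where
  "emb f = Bcontfun (\<lambda>i. f (from_nat i))"

definition coord :: "(nat \<Rightarrow>\<^sub>C real) \<Rightarrow> letter list \<Rightarrow> real" where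
  "coord x v = apply_bcontfun x (to_nat v)"

lemma apply_emb: assumes "f \<in> tree" shows "apply_bcontfun (emb f) i = f (from_nat i)"
proof -
  have "(\<lambda>i. f (from_nat i)) \<in> bcontfun"
    using tree_bounds[OF assms] by (intro bcontfun_normI[where b = 1]) auto
  then show ?thesis by (simp add: emb_def Bcontfun_inverse)
qed

lemma coord_emb: "f \<in> tree \<Longrightarrow> coord (emb f) = f"
  by (simp add: coord_def apply_emb fun_eq_iff)

lemma dist_emb_le:
  assumes "f \<in> tree" "g \<in> tree" "\<And>v. \<bar>f v - g v\<bar> \<le> e" shows "dist (emb f) (emb g) \<le> e"
  by (rule dist_bound) (use assms in \<open>auto simp: apply_emb dist_real_def\<close>)

lemma coord_le_dist: "\<bar>coord x v - coord y v\<bar> \<le> dist x y"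
  unfolding coord_def dist_real_def[symmetric] by (rule dist_bounded)

lemma continuous_coord: "continuous_on A (\<lambda>x. coord x v)"
  unfolding continuous_on_iff dist_real_def
  using coord_le_dist by (metis le_less_trans)

definition tree_cover :: "int \<Rightarrow> (model_point \<times> (nat \<Rightarrow>\<^sub>C real)) set" where
  "tree_cover k = {(z, emb f) |z f. z \<in> model \<and> f \<in> fiber k z}"

lemma sheet_in_tree: "z \<in> model \<Longrightarrow> reduced_word w \<Longrightarrow> sheet k c w z \<in> tree"
  using sheet_in_fiber fiber_subset_tree by blast

proposition covering_space_tree_cover: "covering_space (tree_cover k) fst model"
proof
  show "continuous_on (tree_cover k) fst" by (intro continuous_intros)
  show "fst ` tree_cover k = model"
  proof
    show "model \<subseteq> fst ` tree_cover k"
    proof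
      fix z assume "z \<in> model"
      then have "(z, emb (sheet k 0 [] z)) \<in> tree_cover k"
        using sheet_in_fiber[of "[]" k 0 z] \<open>z \<in> model\<close> unfolding tree_cover_def by (metis (mono_tags, lifting) mem_Collect_eq reduced_word.simps(1))
      then show "z \<in> fst ` tree_cover k" by force
    qed
  qed (auto simp: tree_cover_def)
next
  fix z0 assume z0: "z0 \<in> model"
  obtain c :: real where c: "0 < c" "c < 1" and zc: "z0 \<in> cut_model k c"
  proof (cases "ang z0 = 1/2")
    case True then show ?thesis using that[of "1/3"] z0 by (simp add: cut_model_def)
  next
    case False then show ?thesis using that[of "1/2"] z0 by (simp add: cut_model_def)
  qed
  let ?U = "cut_model k c"
  define S where "S w = (\<lambda>z. (z, emb (sheet k c w z))) ` ?U" for w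
  have Um: "?U \<subseteq> model" by (auto simp: cut_model_def)
  have opU: "openin (top_of_set model) ?U"
    unfolding openin_euclidean_subtopology_iff
  proof (intro conjI ballI Um)
    fix z assume "z \<in> ?U"
    from sheet_near[OF this c, of 1] show "\<exists>e>0. \<forall>z'\<in>model. dist z' z < e \<longrightarrow> z' \<in> ?U" by auto
  qed
  have contS: "continuous_on ?U (\<lambda>z. (z, emb (sheet k c w z)))" if w: "reduced_word w" for w
  proof -
    have "continuous_on ?U (\<lambda>z. emb (sheet k c w z))"
      unfolding continuous_on_iff
    proof (intro ballI allI impI)
      fix z and e :: real assume z: "z \<in> ?U" and e: "e > 0"
      obtain d where d: "d > 0" "\<And>z'. z' \<in> model \<Longrightarrow> dist z' z < d \<Longrightarrow>
            (\<forall>w v. \<bar>sheet k c w z' v - sheet k c w z v\<bar> \<le> e / 2)"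
        using sheet_near[OF z c, of "e / 2"] e by auto
      have "dist (emb (sheet k c w z')) (emb (sheet k c w z)) < e" if "z' \<in> ?U" "dist z' z < d" for z'
      proof -
        have "dist (emb (sheet k c w z')) (emb (sheet k c w z)) \<le> e / 2"
          using that z Um d(2)[of z'] w by (intro dist_emb_le sheet_in_tree) auto
        then show ?thesis using e by simp
      qed
      then show "\<exists>d>0. \<forall>z'\<in>?U. dist z' z < d \<longrightarrow> dist (emb (sheet k c w z')) (emb (sheet k c w z)) < e"
        using d(1) by blast
    qed
    then show ?thesis by (intro continuous_intros)
  qed
  have Un: "tree_cover k \<inter> fst -` ?U = (\<Union>w\<in>Collect reduced_word. S w)"
  proof (intro equalityI subsetI)
    fix x assume "x \<in> tree_cover k \<inter> fst -` ?U"
    then obtain z f where x: "x = (z, emb f)" "z \<in> ?U" "f \<in> fiber k z" by (auto simp: tree_cover_def)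
    then show "x \<in> (\<Union>w\<in>Collect reduced_word. S w)" using fiber_eq_sheets[OF x(2)] by (auto simp: S_def)
  next
    fix x assume "x \<in> (\<Union>w\<in>Collect reduced_word. S w)"
    then obtain w z where w: "reduced_word w" "z \<in> ?U" and x: "x = (z, emb (sheet k c w z))" by (auto simp: S_def)
    have "x \<in> tree_cover k" using sheet_in_fiber[OF w(1), of k c z] w(2) Um x unfolding tree_cover_def by blast
    then show "x \<in> tree_cover k \<inter> fst -` ?U" using x w by simp
  qed
  have sep: "w' = w" if "z' \<in> ?U" "z \<in> ?U" "reduced_word w" "reduced_word w'" "sheet k c w' z = sheet k c w z" for z z' w w'
    using sheet_separation[OF that(2) c] that(2,5) by (metis abs_zero diff_self)
  have opS: "openin (top_of_set (tree_cover k)) (S w)" if w: "reduced_word w" for w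
    unfolding openin_euclidean_subtopology_iff
  proof (intro conjI ballI)
    show "S w \<subseteq> tree_cover k" using Un w by auto
    fix x assume "x \<in> S w"
    then obtain z where x: "x = (z, emb (sheet k c w z))" "z \<in> ?U" by (auto simp: S_def)
    obtain d1 where d1: "d1 > 0" "\<And>z'. z' \<in> model \<Longrightarrow> dist z' z < d1 \<Longrightarrow> z' \<in> ?U"
      using sheet_near[OF x(2) c, of 1] by auto
    from sheet_separation[OF x(2) c] obtain d2 where d2': "d2 > 0"
      "\<forall>z'\<in>?U. \<forall>w w'. (\<forall>v. \<bar>sheet k c w' z' v - sheet k c w z v\<bar> < d2) \<longrightarrow> w' = w"
      by (elim exE conjE)
    have d2: "d2 > 0" "\<And>z' w'. z' \<in> ?U \<Longrightarrow> (\<And>v. \<bar>sheet k c w' z' v - sheet k c w z v\<bar> < d2) \<Longrightarrow> w' = w"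
      using d2' by metis+
    show "\<exists>e>0. \<forall>x'\<in>tree_cover k. dist x' x < e \<longrightarrow> x' \<in> S w"
    proof (intro exI conjI ballI impI)
      show "min d1 d2 > 0" using d1 d2 by simp
      fix x' assume x': "x' \<in> tree_cover k" "dist x' x < min d1 d2"
      have "fst x' \<in> ?U"
        using d1(2)[of "fst x'"] x' dist_fst_le[of x' x] x by (auto simp: tree_cover_def)
      then obtain w' where w': "reduced_word w'" "x' \<in> S w'" using Un x'(1) by auto
      then obtain z' where z': "z' \<in> ?U" "x' = (z', emb (sheet k c w' z'))" by (auto simp: S_def)
      have "\<bar>sheet k c w' z' v - sheet k c w z v\<bar> < d2" for v
        using coord_le_dist[of "snd x'" v "snd x"] dist_snd_le[of x' x] x' x z' w w' Um
        by (auto simp: coord_emb[OF sheet_in_tree] subset_eq)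
      then have "w' = w" using d2(2) z' by blast
      then show "x' \<in> S w" using w' by simp
    qed
  qed
  have disj: "disjnt (S w) (S w')" if "reduced_word w" "reduced_word w'" "S w \<noteq> S w'" for w w'
  proof (rule ccontr)
    assume "\<not> disjnt (S w) (S w')"
    then obtain z where z: "z \<in> ?U" "emb (sheet k c w z) = emb (sheet k c w' z)" by (auto simp: disjnt_def S_def)
    then have "sheet k c w z = sheet k c w' z" using coord_emb[OF sheet_in_tree] that Um by (metis subsetD)
    then show False using sep[OF z(1) z(1)] that by metis
  qed
  have hom: "\<exists>q. homeomorphism (S w) ?U fst q" if "reduced_word w" for w
    by (rule exI[of _ "\<lambda>z. (z, emb (sheet k c w z))"])
      (use contS[OF that] in \<open>auto simp: homeomorphism_def S_def image_image intro!: continuous_intros\<close>)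
  show "\<exists>T. z0 \<in> T \<and> openin (top_of_set model) T \<and>
              (\<exists>\<V>. \<Union>\<V> = tree_cover k \<inter> fst -` T \<and> (\<forall>u\<in>\<V>. openin (top_of_set (tree_cover k)) u) \<and>
                   pairwise disjnt \<V> \<and> (\<forall>u\<in>\<V>. \<exists>q. homeomorphism u T fst q))"
    by (rule exI[of _ ?U], intro conjI zc opU, rule exI[of _ "S ` Collect reduced_word"])
       (use Un opS disj hom in \<open>auto simp: pairwise_def\<close>)
qed

section \<open>Lifted loops and their heights\<close>

lemma ang_near_axis:
  assumes z: "z \<in> model" "snd z = 0 \<or> circ z \<noteq> n" and e: "e > 0"
  shows "\<exists>d>0. \<forall>z'\<in>model. dist z' z < d \<longrightarrow>
           snd z' = 0 \<or> circ z' \<noteq> n \<or> min (ang z') (1 - ang z') < e"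
proof (cases "snd z = 0")
  case False
  then show ?thesis using circ_locally_constant[OF z(1)] z(2) by metis
next
  case True
  define B where "B = \<bar>real_of_int n\<bar> + \<bar>fst z\<bar> + 1"
  have B: "B > 0" by (simp add: B_def)
  define q where "q = min e 1"
  have q: "q > 0" "q \<le> e" "q \<le> 1" using e by (auto simp: q_def)
  define d where "d = min 1 (q / B)"
  have d: "d > 0" "d \<le> 1" "d \<le> q / B" using q B by (auto simp: d_def)
  have "min (ang z') (1 - ang z') < e"
    if z': "z' \<in> model" "dist z' z < d" and nz: "snd z' \<noteq> 0" and n: "circ z' = n" for z'
  proof -
    have "\<bar>fst z' - fst z\<bar> < 1" "norm (snd z') < d"
      using dist_fst_le[of z' z] dist_snd_le[of z' z] z' True d by (auto simp: dist_real_def)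
    then have "of_int (circ z') + fst z' \<le> B" unfolding n B_def by linarith
    then have "(of_int (circ z') + fst z') * norm (snd z') \<le> B * (q / B)"
      using \<open>norm (snd z') < d\<close> d B by (intro mult_mono) auto
    then have le: "(of_int (circ z') + fst z') * norm (snd z') \<le> q" using B by simp
    have nn: "0 \<le> (of_int (circ z') + fst z') * norm (snd z')" using model_off_axis(1)[OF z'(1) nz] by simp
    have "((of_int (circ z') + fst z') * norm (snd z'))\<^sup>2 / 16 \<le> q\<^sup>2 / 16"
      using power_mono[OF le nn, of 2] by simp
    also have "\<dots> \<le> q / 16" using q(1) mult_left_mono[OF q(3), of q] by (simp add: power2_eq_square)
    finally have pq: "ang z' * (1 - ang z') \<le> q / 16" unfolding model_off_axis(7)[OF z'(1) nz] .
    have a: "0 < ang z'" "ang z' < 1" using model_off_axis[OF z'(1) nz] by auto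
    have "min (ang z') (1 - ang z') * (1/2) \<le> ang z' * (1 - ang z')"
    proof (cases "ang z' \<le> 1/2")
      case True then show ?thesis using mult_left_mono[of "1/2" "1 - ang z'" "ang z'"] a by auto
    next
      case False then show ?thesis using mult_right_mono[of "1/2" "ang z'" "1 - ang z'"] a by auto
    qed
    also note pq
    finally have "min (ang z') (1 - ang z') * (1/2) \<le> q / 16" .
    moreover have "m * (1/2) \<le> q / 16 \<Longrightarrow> m < e" for m using q by linarith
    ultimately show ?thesis by blast
  qed
  then show ?thesis using d(1) by blast
qed

definition is_lift :: "(real \<Rightarrow> model_point) \<Rightarrow> int \<Rightarrow> (real \<Rightarrow> letter list \<Rightarrow> real) \<Rightarrow> bool" where
  "is_lift \<alpha> k f \<longleftrightarrow> (\<forall>t\<in>{0..1}. f t \<in> fiber k (\<alpha> t)) \<and> (\<forall>v. continuous_on {0..1} (\<lambda>t. f t v))"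

lemma vert_01: "vert w v = 0 \<or> vert w v = 1"
  by (simp add: vert_def)

lemma fiber_off_circle:
  assumes "f \<in> fiber k z" "snd z = 0 \<or> circ z \<noteq> n \<or> k < n" "fst (hd v) = n"
  shows "f v = 0 \<or> f v = 1"
proof (cases "trivial_at k z")
  case True
  then obtain w where "f = vert w" using assms(1) by (auto simp: fiber_def)
  then show ?thesis using vert_01 by simp
next
  case False
  then obtain w b where f: "f = edge_pt w (circ z, b) (if b then ang z else 1 - ang z)"
    using assms(1) by (auto simp: fiber_def)
  have "circ z \<noteq> n" using assms(2) False by (auto simp: trivial_at_def)
  then have "v \<noteq> (circ z, b) # w" using assms(3) by auto
  then have "f v = vert w v" unfolding f by (rule edge_pt_simps(2))
  then show ?thesis using vert_01 by simp
qed

lemma fiber_on_circle: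
  assumes "f \<in> fiber k z" "snd z \<noteq> 0" "circ z \<le> k"
  obtains v where "f v = (if snd (hd v) then ang z else 1 - ang z)" "v \<noteq> []" "fst (hd v) = circ z"
    "\<And>u. u \<noteq> v \<Longrightarrow> f u = 0 \<or> f u = 1"
proof -
  have "\<not> trivial_at k z" using assms by (simp add: trivial_at_def)
  then obtain w b where f: "f = edge_pt w (circ z, b) (if b then ang z else 1 - ang z)"
    using assms(1) by (auto simp: fiber_def)
  show ?thesis
  proof (rule that[of "(circ z, b) # w"])
    show "f u = 0 \<or> f u = 1" if "u \<noteq> (circ z, b) # w" for u
      using edge_pt_simps(2)[OF that] vert_01 by (simp add: f)
  qed (simp_all add: f edge_pt_simps(1))
qed

lemma avoids_side:
  fixes g :: "real \<Rightarrow> real"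
  assumes "connected I" "continuous_on I g" "\<And>x. x \<in> I \<Longrightarrow> g x \<noteq> c" "x \<in> I" "y \<in> I" "g x < c"
  shows "g y < c"
proof (rule ccontr)
  assume "\<not> g y < c"
  moreover have "connected (g ` I)" using assms by (intro connected_continuous_image)
  ultimately have "c \<in> g ` I"
    using assms(4-6) connectedD_interval[of "g ` I" "g x" "g y" c] by (auto simp: not_less)
  then show False using assms(3) by blast
qed

lemma letter_dist_small:
  assumes \<alpha>: "continuous_on {0..1} \<alpha>" "\<alpha> ` {0..1} \<subseteq> model" and t0: "t0 \<in> {0..1}" and e: "0 < e"
  shows "\<exists>d>0. \<forall>k f. is_lift \<alpha> k f \<longrightarrow> (\<forall>t\<in>{0..1}. \<bar>t - t0\<bar> < d \<longrightarrow> letter_dist n (f t0) (f t) \<le> e)"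
proof -
  have am: "\<alpha> t \<in> model" if "t \<in> {0..1}" for t using \<alpha> that by auto
  have near: "\<exists>d>0. \<forall>t\<in>{0..1}. \<bar>t - t0\<bar> < d \<longrightarrow> dist (\<alpha> t) (\<alpha> t0) < d'" if "d' > 0" for d' :: real
    using \<alpha>(1) t0 that unfolding continuous_on_iff dist_real_def by metis
  define I where "I d = {t \<in> {0..1}. \<bar>t - t0\<bar> < d}" for d
  have I: "connected (I d)" "t0 \<in> I d" "I d \<subseteq> {0..1}" if "d > 0" for d
  proof -
    have "I d = {0..1} \<inter> {t0 - d<..<t0 + d}" by (auto simp: I_def)
    then have "is_interval (I d)" by (simp add: is_interval_Int is_interval_cc is_interval_oo)
    then show "connected (I d)" by (rule is_interval_connected)
  qed (use t0 that in \<open>auto simp: I_def\<close>)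
  show ?thesis
  proof (cases "snd (\<alpha> t0) = 0 \<or> circ (\<alpha> t0) \<noteq> n")
    case off: True
    define e1 where "e1 = min e (1/4)"
    have e1: "e1 > 0" "e1 \<le> e" "e1 < 1/2" using e by (auto simp: e1_def)
    obtain d' where d': "d' > 0" "\<And>z'. z' \<in> model \<Longrightarrow> dist z' (\<alpha> t0) < d' \<Longrightarrow>
           snd z' = 0 \<or> circ z' \<noteq> n \<or> min (ang z') (1 - ang z') < e1"
      using ang_near_axis[OF am[OF t0] off e1(1)] by metis
    obtain d where d: "d > 0" "\<And>t. t \<in> {0..1} \<Longrightarrow> \<bar>t - t0\<bar> < d \<Longrightarrow> dist (\<alpha> t) (\<alpha> t0) < d'"
      using near[OF d'(1)] by metis
    have "letter_dist n (f t0) (f t) \<le> e" if f: "is_lift \<alpha> k f" and t: "t \<in> {0..1}" "\<bar>t - t0\<bar> < d" for k f t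
    proof -
      have ff: "f s \<in> fiber k (\<alpha> s)" "f s \<in> tree" if "s \<in> {0..1}" for s
        using f that fiber_subset_tree[OF am[OF that], of k] unfolding is_lift_def by blast+
      have tI: "t \<in> I d" using t by (auto simp: I_def)
      have vals: "(\<exists>v0. (\<forall>v. fst (hd v) = n \<longrightarrow> v \<noteq> v0 \<longrightarrow> f s v = 0 \<or> f s v = 1) \<and> (f s v0 < e1 \<or> f s v0 > 1 - e1))"
        if s: "s \<in> I d" for s
      proof -
        have s01: "s \<in> {0..1}" and sd: "\<bar>s - t0\<bar> < d" using s by (auto simp: I_def)
        show ?thesis
        proof (cases "snd (\<alpha> s) = 0 \<or> circ (\<alpha> s) \<noteq> n \<or> k < n")
          case True
          show ?thesis
            by (rule exI[of _ "[]"], intro conjI allI impI)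
              (use fiber_off_circle[OF ff(1)[OF s01] True] tree_Nil[OF ff(2)[OF s01]] e1 in auto)
        next
          case False
          then have F: "snd (\<alpha> s) \<noteq> 0" "circ (\<alpha> s) \<le> k" "circ (\<alpha> s) = n" by auto
          obtain v where v: "f s v = (if snd (hd v) then ang (\<alpha> s) else 1 - ang (\<alpha> s))"
            "\<And>u. u \<noteq> v \<Longrightarrow> f s u = 0 \<or> f s u = 1"
            using fiber_on_circle[OF ff(1)[OF s01] F(1,2)] by metis
          have "min (ang (\<alpha> s)) (1 - ang (\<alpha> s)) < e1" using d'(2)[OF am[OF s01] d(2)[OF s01 sd]] F by auto
          then have "f s v < e1 \<or> f s v > 1 - e1" unfolding v(1) by auto
          then show ?thesis using v(2) by blast
        qed
      qed
      have v01: "f s v < e1 \<or> f s v > 1 - e1" if "s \<in> I d" "fst (hd v) = n" for s v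
        using vals[OF that(1)] that(2) e1 by (metis (no_types, opaque_lifting) diff_gt_0_iff_gt less_add_same_cancel1 add.commute diff_less_eq)
      have side: "f s v < 1/2 \<longleftrightarrow> f s' v < 1/2" if "s \<in> I d" "s' \<in> I d" "fst (hd v) = n" for s s' v
      proof -
        have c: "continuous_on (I d) (\<lambda>t. f t v)"
          using f I[OF d(1)] by (auto simp: is_lift_def elim: continuous_on_subset)
        have "f x v \<noteq> 1/2" if "x \<in> I d" for x using v01[OF that \<open>fst (hd v) = n\<close>] e1(3) by auto
        then show ?thesis using avoids_side[OF I(1)[OF d(1)] c] that(1,2) by metis
      qed
      obtain v0 where v0: "\<And>v. fst (hd v) = n \<Longrightarrow> v \<noteq> v0 \<Longrightarrow> f t v = 0 \<or> f t v = 1" "f t v0 < e1 \<or> f t v0 > 1 - e1"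
        using vals[OF tI] by metis
      have f0: "f t0 v = 0 \<or> f t0 v = 1" if "fst (hd v) = n" for v
        using fiber_off_circle[OF ff(1)[OF t0] _ that] off by blast
      have eq: "f t0 u = f t u" if "u \<noteq> v0" "fst (hd u) = n" for u
        using v0(1)[OF that(2,1)] f0[OF that(2)] side[OF I(2)[OF d(1)] tI that(2)] by auto
      show ?thesis
      proof (cases "fst (hd v0) = n")
        case True
        have "\<bar>f t0 v0 - f t v0\<bar> \<le> e"
          using f0[OF True] side[OF I(2)[OF d(1)] tI True] v0(2) e1 tree_bounds[OF ff(2)[OF t(1)], of v0] by auto
        then show ?thesis using letter_dist_le[OF ff(2)[OF t0] ff(2)[OF t(1)], of v0 n e] eq by blast
      next
        case False
        then have "\<And>u. fst (hd u) = n \<Longrightarrow> f t0 u = f t u" using eq by metis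
        moreover have "\<bar>f t0 [] - f t []\<bar> \<le> e"
          using tree_Nil[OF ff(2)[OF t0]] tree_Nil[OF ff(2)[OF t(1)]] e by auto
        ultimately show ?thesis using letter_dist_le[OF ff(2)[OF t0] ff(2)[OF t(1)], of "[]" n e] by blast
      qed
    qed
    then show ?thesis using d(1) by blast
  next
    case on: False
    define a0 where "a0 = ang (\<alpha> t0)"
    have a0: "0 < a0" "a0 < 1" using model_off_axis(5,6)[OF am[OF t0]] on by (auto simp: a0_def)
    define e2 where "e2 = min e (min a0 (1 - a0) / 2)"
    have e2: "e2 > 0" "e2 \<le> e" "e2 < a0" "e2 < 1 - a0" using e a0 by (auto simp: e2_def min_less_iff_disj)
    obtain d1 where d1: "d1 > 0" "\<And>z'. z' \<in> model \<Longrightarrow> dist z' (\<alpha> t0) < d1 \<Longrightarrow> snd z' \<noteq> 0 \<and> circ z' = n"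
      using circ_locally_constant[OF am[OF t0]] on by metis
    obtain d2 where d2: "d2 > 0" "\<And>z'. dist z' (\<alpha> t0) < d2 \<Longrightarrow> \<bar>ang z' - a0\<bar> < e2"
      using ang_isCont[of "\<alpha> t0"] on e2(1) unfolding continuous_at_eps_delta dist_real_def a0_def by metis
    obtain d where d: "d > 0" "\<And>t. t \<in> {0..1} \<Longrightarrow> \<bar>t - t0\<bar> < d \<Longrightarrow> dist (\<alpha> t) (\<alpha> t0) < min d1 d2"
      using near[of "min d1 d2"] d1 d2 by (metis min_less_iff_conj)
    have loc: "snd (\<alpha> s) \<noteq> 0" "circ (\<alpha> s) = n" "\<bar>ang (\<alpha> s) - a0\<bar> < e2" if "s \<in> I d" for s
      using d1(2)[of "\<alpha> s"] d2(2)[of "\<alpha> s"] d(2)[of s] am[of s] that by (auto simp: I_def)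
    have "letter_dist n (f t0) (f t) \<le> e" if f: "is_lift \<alpha> k f" and t: "t \<in> {0..1}" "\<bar>t - t0\<bar> < d" for k f t
    proof -
      have ff: "f s \<in> fiber k (\<alpha> s)" "f s \<in> tree" if "s \<in> {0..1}" for s
        using f that fiber_subset_tree[OF am[OF that], of k] unfolding is_lift_def by blast+
      have tI: "t \<in> I d" using t by (auto simp: I_def)
      have cv: "continuous_on (I d) (\<lambda>t. f t v)" for v
        using f I[OF d(1)] by (auto simp: is_lift_def elim: continuous_on_subset)
      have const: "f t0 v = f t v" if "\<And>s. s \<in> I d \<Longrightarrow> f s v = 0 \<or> f s v = 1" for v
      proof -
        have "f x v \<noteq> 1/2" if "x \<in> I d" for x using \<open>\<And>s. s \<in> I d \<Longrightarrow> f s v = 0 \<or> f s v = 1\<close>[OF that] by auto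
        then have "f t0 v < 1/2 \<longleftrightarrow> f t v < 1/2" using avoids_side[OF I(1)[OF d(1)] cv] I(2)[OF d(1)] tI by metis
        then show ?thesis using that[OF I(2)[OF d(1)]] that[OF tI] by auto
      qed
      show ?thesis
      proof (cases "k < n")
        case True
        have "f s v = 0 \<or> f s v = 1" if "s \<in> I d" "fst (hd v) = n" for s v
          using fiber_off_circle[OF ff(1) _ that(2)] True that(1) I(3)[OF d(1)] by blast
        then have "\<And>v. fst (hd v) = n \<Longrightarrow> f t0 v = f t v" using const by blast
        moreover have "\<bar>f t0 [] - f t []\<bar> \<le> e"
          using tree_Nil[OF ff(2)[OF t0]] tree_Nil[OF ff(2)[OF t(1)]] e by auto
        ultimately show ?thesis using letter_dist_le[OF ff(2)[OF t0] ff(2)[OF t(1)], of "[]" n e] by blast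
      next
        case False
        have fr: "\<exists>v. f s v = (if snd (hd v) then ang (\<alpha> s) else 1 - ang (\<alpha> s)) \<and> (\<forall>u. u \<noteq> v \<longrightarrow> f s u = 0 \<or> f s u = 1)"
          if s: "s \<in> I d" for s
        proof -
          have "s \<in> {0..1}" using s by (auto simp: I_def)
          with fiber_on_circle[OF ff(1) loc(1)[OF s]] loc(2)[OF s] False show ?thesis by (metis not_less)
        qed
        obtain v0 where v0: "f t0 v0 = (if snd (hd v0) then a0 else 1 - a0)"
          "\<And>u. u \<noteq> v0 \<Longrightarrow> f t0 u = 0 \<or> f t0 u = 1"
          using fr[OF I(2)[OF d(1)]] unfolding a0_def by metis
        define s0 where "s0 = f t0 v0"
        have s0: "e2 < s0" "s0 + e2 < 1" using e2 v0(1) by (auto simp: s0_def)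
        have val: "f s v0 = 0 \<or> f s v0 = 1 \<or> \<bar>f s v0 - s0\<bar> < e2" if s: "s \<in> I d" for s
        proof -
          obtain v where v: "f s v = (if snd (hd v) then ang (\<alpha> s) else 1 - ang (\<alpha> s))" "\<And>u. u \<noteq> v \<Longrightarrow> f s u = 0 \<or> f s u = 1"
            using fr[OF s] by metis
          show ?thesis
          proof (cases "v = v0")
            case True
            then show ?thesis using v(1) v0(1) loc(3)[OF s] by (auto simp: s0_def split: if_splits)
          next
            case False
            then show ?thesis using v(2)[of v0] by blast
          qed
        qed
        have ne: "f x v0 \<noteq> s0 - e2" "f x v0 \<noteq> s0 + e2" if "x \<in> I d" for x using val[OF that] s0 e2 by auto
        have stay: "\<bar>f s v0 - s0\<bar> < e2" if s: "s \<in> I d" for s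
        proof -
          have "\<not> f s v0 < s0 - e2"
            using avoids_side[OF I(1)[OF d(1)] cv ne(1) s I(2)[OF d(1)]] e2(1) by (auto simp: s0_def)
          moreover have "f s v0 < s0 + e2"
            using avoids_side[OF I(1)[OF d(1)] cv ne(2) I(2)[OF d(1)] s] e2(1) by (auto simp: s0_def)
          ultimately show ?thesis using ne[OF s] by auto
        qed
        have other: "f s u = 0 \<or> f s u = 1" if s: "s \<in> I d" and u: "u \<noteq> v0" for s u
        proof -
          obtain v where v: "\<And>u. u \<noteq> v \<Longrightarrow> f s u = 0 \<or> f s u = 1" using fr[OF s] by metis
          have "f s v0 \<noteq> 0" "f s v0 \<noteq> 1" using stay[OF s] s0 by auto
          then have "v = v0" using v by metis
          then show ?thesis using v u by blast
        qed
        show ?thesis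
        proof (rule letter_dist_le[OF ff(2)[OF t0] ff(2)[OF t(1)], of v0])
          show "f t0 u = f t u" if "u \<noteq> v0" for u using const other that by blast
          show "\<bar>f t0 v0 - f t v0\<bar> \<le> e" using stay[OF tI] e2(2) by (auto simp: s0_def)
        qed
      qed
    qed
    then show ?thesis using d(1) by blast
  qed
qed

lemma letter_dist_triangle:
  "f \<in> tree \<Longrightarrow> g \<in> tree \<Longrightarrow> h \<in> tree \<Longrightarrow> letter_dist n f h \<le> letter_dist n f g + letter_dist n g h"
  unfolding letter_dist_def by (rule word_dist_triangle) auto

lemma letter_dist_commute: "letter_dist n f g = letter_dist n g f"
  unfolding letter_dist_def by (rule word_dist_commute)

lemma is_lift_tree:
  "is_lift \<alpha> k f \<Longrightarrow> \<alpha> ` {0..1} \<subseteq> model \<Longrightarrow> t \<in> {0..1} \<Longrightarrow> f t \<in> tree"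
  using fiber_subset_tree[of "\<alpha> t" k] unfolding is_lift_def by blast

lemma letter_dist_bounded:
  assumes \<alpha>: "continuous_on {0..1} \<alpha>" "\<alpha> ` {0..1} \<subseteq> model"
  shows "\<exists>N. \<forall>k f. is_lift \<alpha> k f \<longrightarrow> (\<forall>s\<in>{0..1}. \<forall>t\<in>{0..1}. letter_dist n (f s) (f t) \<le> N)"
proof -
  define P where "P a b \<longleftrightarrow> (\<exists>N. \<forall>k f. is_lift \<alpha> k f \<longrightarrow> (\<forall>s\<in>{a..b} \<inter> {0..1}. \<forall>t\<in>{a..b} \<inter> {0..1}. letter_dist n (f s) (f t) \<le> N))" for a b
  have "P 0 1"
  proof (rule Bolzano)
    show "(0::real) \<le> 1" by simp
  next
    fix a b c assume "P a b" "P b c" and le: "a \<le> b" "b \<le> c"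
    then obtain N1 N2 where N1: "\<And>k f s t. is_lift \<alpha> k f \<Longrightarrow> s \<in> {a..b} \<inter> {0..1} \<Longrightarrow> t \<in> {a..b} \<inter> {0..1} \<Longrightarrow> letter_dist n (f s) (f t) \<le> N1"
      and N2: "\<And>k f s t. is_lift \<alpha> k f \<Longrightarrow> s \<in> {b..c} \<inter> {0..1} \<Longrightarrow> t \<in> {b..c} \<inter> {0..1} \<Longrightarrow> letter_dist n (f s) (f t) \<le> N2"
      unfolding P_def by metis
    have "letter_dist n (f s) (f t) \<le> \<bar>N1\<bar> + \<bar>N2\<bar>"
      if f: "is_lift \<alpha> k f" and s: "s \<in> {a..c} \<inter> {0..1}" and t: "t \<in> {a..c} \<inter> {0..1}" for k f s t
    proof -
      have *: "letter_dist n (f s) (f t) \<le> \<bar>N1\<bar> + \<bar>N2\<bar>" if "s \<le> b" "b \<le> t" "s \<in> {a..c} \<inter> {0..1}" "t \<in> {a..c} \<inter> {0..1}" for s t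
        using letter_dist_triangle[OF is_lift_tree[OF f \<alpha>(2), of s] is_lift_tree[OF f \<alpha>(2), of b] is_lift_tree[OF f \<alpha>(2), of t], of n]
          N1[OF f, of s b] N2[OF f, of b t] that by auto
      consider "s \<le> b" "t \<le> b" | "b \<le> s" "b \<le> t" | "s \<le> b" "b \<le> t" | "t \<le> b" "b \<le> s" by linarith
      then show ?thesis
      proof cases
        case 1 then show ?thesis using N1[OF f, of s t] s t by auto
      next
        case 2 then show ?thesis using N2[OF f, of s t] s t by auto
      next
        case 3 then show ?thesis using *[of s t] s t by auto
      next
        case 4 then show ?thesis using *[of t s] s t letter_dist_commute[of n "f s"] by auto
      qed
    qed
    then show "P a c" unfolding P_def by blast
  next
    fix x :: real assume "0 \<le> x" "x \<le> 1"
    then have x: "x \<in> {0..1}" by simp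
    obtain d where d: "d > 0" "\<And>k f t. is_lift \<alpha> k f \<Longrightarrow> t \<in> {0..1} \<Longrightarrow> \<bar>t - x\<bar> < d \<Longrightarrow> letter_dist n (f x) (f t) \<le> 1"
      using letter_dist_small[OF \<alpha> x zero_less_one] by metis
    have "P a b" if ab: "a \<le> x \<and> x \<le> b \<and> b - a < d" for a b
    proof -
      have "letter_dist n (f s) (f t) \<le> 2"
        if f: "is_lift \<alpha> k f" and s: "s \<in> {a..b} \<inter> {0..1}" and t: "t \<in> {a..b} \<inter> {0..1}" for k f s t
      proof -
        have "letter_dist n (f x) (f s) \<le> 1" "letter_dist n (f x) (f t) \<le> 1"
          using d(2)[OF f, of s] d(2)[OF f, of t] s t ab by auto
        then show ?thesis
          using letter_dist_triangle[OF is_lift_tree[OF f \<alpha>(2), of s] is_lift_tree[OF f \<alpha>(2), of x] is_lift_tree[OF f \<alpha>(2), of t], of n]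
            letter_dist_commute[of n "f s" "f x"] s t x by auto
      qed
      then show ?thesis unfolding P_def by blast
    qed
    then show "\<exists>d>0. \<forall>a b. a \<le> x \<and> x \<le> b \<and> b - a < d \<longrightarrow> P a b" using d(1) by blast
  qed
  then show ?thesis unfolding P_def by simp
qed

lemma sum_half_powers_le:
  assumes "finite F" "\<And>n. n \<in> F \<Longrightarrow> M \<le> to_nat (n :: int)"
  shows "(\<Sum>n\<in>F. (1/2 :: real) ^ to_nat n) \<le> 2 * (1/2) ^ M"
proof -
  have inj: "inj_on to_nat F" by (auto intro: inj_onI)
  obtain L where L: "to_nat ` F \<subseteq> {M..<M + L}"
  proof -
    obtain b where "\<And>i. i \<in> to_nat ` F \<Longrightarrow> i < b"
      using finite_nat_set_iff_bounded[of "to_nat ` F"] assms(1) by auto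
    then have "to_nat ` F \<subseteq> {M..<M + b}" using assms(2) by (force intro: trans_less_add2)
    then show ?thesis using that by blast
  qed
  have "(\<Sum>n\<in>F. (1/2 :: real) ^ to_nat n) = (\<Sum>i\<in>to_nat ` F. (1/2) ^ i)"
    using sum.reindex[OF inj, of "\<lambda>i. (1/2 :: real) ^ i"] by (simp add: o_def)
  also have "\<dots> \<le> (\<Sum>i\<in>{M..<M + L}. (1/2) ^ i)" by (rule sum_mono2) (use L in auto)
  also have "\<dots> = (1/2) ^ M * (\<Sum>i<L. (1/2) ^ i)"
    using sum.shift_bounds_nat_ivl[of "\<lambda>i. (1/2 :: real) ^ i" 0 M L]
    by (simp add: add.commute mult.commute sum_distrib_left power_add lessThan_atLeast0)
  also have "(\<Sum>i<L. (1/2 :: real) ^ i) \<le> 2"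
  proof -
    have "(\<Sum>i<L. (1/2 :: real) ^ i) = 2 - 2 * (1/2) ^ L" by (induction L) auto
    then show ?thesis by simp
  qed
  finally show ?thesis by (simp add: mult.commute)
qed

definition same_spot :: "model_point \<Rightarrow> model_point \<Rightarrow> bool" where
  "same_spot z z' \<longleftrightarrow> (snd z = 0 \<longleftrightarrow> snd z' = 0) \<and> (snd z \<noteq> 0 \<longrightarrow> circ z = circ z' \<and> ang z = ang z')"

lemma same_spot_sym: "same_spot z z' \<Longrightarrow> same_spot z' z"
  by (auto simp: same_spot_def)

lemma fiber_separates:
  assumes z: "z \<in> model" "z' \<in> model" "\<not> same_spot z z'"
  shows "\<exists>n d. d > 0 \<and> (\<forall>k f f'. n \<le> k \<longrightarrow> f \<in> fiber k z \<longrightarrow> f' \<in> fiber k z' \<longrightarrow> (\<exists>v. fst (hd v) = n \<and> d \<le> \<bar>f v - f' v\<bar>))"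
proof -
  have *: "\<exists>n d. d > 0 \<and> (\<forall>k f f'. n \<le> k \<longrightarrow> f \<in> fiber k z \<longrightarrow> f' \<in> fiber k z' \<longrightarrow> (\<exists>v. fst (hd v) = n \<and> d \<le> \<bar>f v - f' v\<bar>))"
    if z: "z \<in> model" "z' \<in> model" "\<not> same_spot z z'" "snd z \<noteq> 0" for z z'
  proof -
    let ?n = "circ z"
    define on' where "on' \<longleftrightarrow> snd z' \<noteq> 0 \<and> circ z' = ?n"
    define d where "d = min (min (ang z) (1 - ang z)) (if on' then \<bar>ang z - ang z'\<bar> else 1)"
    have a: "0 < ang z" "ang z < 1" using model_off_axis[OF z(1,4)] by auto
    have "d > 0" using a z(3,4) by (auto simp: d_def on'_def same_spot_def)
    moreover have "\<exists>v. fst (hd v) = ?n \<and> d \<le> \<bar>f v - f' v\<bar>"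
      if k: "?n \<le> k" and f: "f \<in> fiber k z" "f' \<in> fiber k z'" for k f f'
    proof -
      obtain v where v: "f v = (if snd (hd v) then ang z else 1 - ang z)" "fst (hd v) = ?n"
        using fiber_on_circle[OF f(1) z(4) k] by metis
      have "f' v = 0 \<or> f' v = 1 \<or> on' \<and> f' v = (if snd (hd v) then ang z' else 1 - ang z')"
      proof (cases on')
        case True
        then have "snd z' \<noteq> 0" "circ z' \<le> k" using k by (auto simp: on'_def)
        then show ?thesis using fiber_on_circle[OF f(2)] True by metis
      next
        case False
        then show ?thesis using fiber_off_circle[OF f(2) _ v(2)] by (auto simp: on'_def)
      qed
      then have "d \<le> \<bar>f v - f' v\<bar>" using v(1) a by (auto simp: d_def split: if_splits)
      then show ?thesis using v(2) by blast
    qed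
    ultimately show ?thesis by blast
  qed
  show ?thesis
  proof (cases "snd z = 0")
    case False
    then show ?thesis using *[OF z] by simp
  next
    case True
    then have "snd z' \<noteq> 0" using z(3) by (auto simp: same_spot_def)
    then show ?thesis using *[OF z(2,1)] z(3) same_spot_sym abs_minus_commute by (metis (no_types, lifting))
  qed
qed

proposition closed_lifts_tree_code:
  assumes \<alpha>: "continuous_on {0..1} \<alpha>" "\<alpha> ` {0..1} \<subseteq> model"
    and f: "\<And>k::nat. is_lift \<alpha> (int k) (f k)" "\<And>k. f k 0 = vert []" "\<And>k. f k 1 = vert []"
  obtains h :: "real \<Rightarrow> real" where "continuous_on {0..1} h" "h 0 = 0" "h 1 = 0"
    "\<And>t. t \<in> {0..1} \<Longrightarrow> 0 \<le> h t"
    "\<And>s t. 0 \<le> s \<Longrightarrow> s \<le> t \<Longrightarrow> t \<le> 1 \<Longrightarrow> h s = h t \<Longrightarrow> \<forall>r\<in>{s..t}. h s \<le> h r \<Longrightarrow> same_spot (\<alpha> s) (\<alpha> t)"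
proof -
  have tr: "f k t \<in> tree" if "t \<in> {0..1}" for k t using is_lift_tree[OF f(1) \<alpha>(2) that] .
  have "\<exists>N. \<forall>n k g. is_lift \<alpha> k g \<longrightarrow> (\<forall>s\<in>{0..1}. \<forall>t\<in>{0..1}. letter_dist n (g s) (g t) \<le> N n)"
    using letter_dist_bounded[OF \<alpha>] by metis
  then obtain N where N: "\<And>n k s t. s \<in> {0..1} \<Longrightarrow> t \<in> {0..1} \<Longrightarrow> letter_dist n (f k s) (f k t) \<le> N n"
    using f(1) by metis
  have N0: "0 \<le> N n" for n
    using N[of 0 0 n 0] by (simp add: letter_dist_def word_dist_def)
  define \<omega> where "\<omega> n = (1/2) ^ to_nat n / (N n + 1)" for n :: int
  have w0: "0 < \<omega> n" for n using N0[of n] by (simp add: \<omega>_def add_nonneg_pos)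
  then have w0': "0 \<le> \<omega> n" for n using less_imp_le by blast
  have wle: "\<omega> n \<le> (1/2) ^ to_nat n" for n
    using N0[of n] by (simp add: \<omega>_def divide_le_eq mult_left_mono)
  have wN: "\<omega> n * letter_dist n (f k s) (f k t) \<le> (1/2) ^ to_nat n" if "s \<in> {0..1}" "t \<in> {0..1}" for n k s t
  proof -
    have "\<omega> n * letter_dist n (f k s) (f k t) \<le> \<omega> n * (N n + 1)"
      using N[OF that, of n k] w0' by (intro mult_left_mono) auto
    also have "\<dots> = (1/2) ^ to_nat n" using N0[of n] by (simp add: \<omega>_def)
    finally show ?thesis .
  qed
  define hk where "hk k t = height \<omega> (f k t)" for k t
  have h0: "hk k 0 = 0" "hk k 1 = 0" for k using f by (auto simp: hk_def height_def word_dist_def)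
  have hnn: "0 \<le> hk k t" for k t unfolding hk_def height_def by (rule word_dist_nonneg[OF w0'])
  have diff: "\<bar>hk k s - hk k t\<bar> \<le> word_dist \<omega> (f k s) (f k t)" if "s \<in> {0..1}" "t \<in> {0..1}" for k s t
    unfolding hk_def by (rule height_diff_le[OF tr[OF that(1)] tr[OF that(2)] w0'])
  define T where "T k s t = (\<lambda>v. fst (hd v)) ` {v. f k s v \<noteq> f k t v}" for k s t
  have finT: "finite (T k s t)" if "s \<in> {0..1}" "t \<in> {0..1}" for k s t
    unfolding T_def using finite_tree_diff[OF tr[OF that(1)] tr[OF that(2)]] by blast
  have wd: "word_dist \<omega> (f k s) (f k t) = (\<Sum>n\<in>T k s t. \<omega> n * letter_dist n (f k s) (f k t))"
    if "s \<in> {0..1}" "t \<in> {0..1}" for k s t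
    unfolding T_def by (rule word_dist_eq_sum_letter_dist[OF tr[OF that(1)] tr[OF that(2)]])
  have bound: "norm (hk k t) \<le> 2" if t: "t \<in> {0..1}" for k t
  proof -
    have z: "(0::real) \<in> {0..1}" by simp
    have "\<bar>hk k t - hk k 0\<bar> \<le> (\<Sum>n\<in>T k t 0. \<omega> n * letter_dist n (f k t) (f k 0))"
      using diff[OF t z, of k] wd[OF t z, of k] by simp
    also have "\<dots> \<le> (\<Sum>n\<in>T k t 0. (1/2) ^ to_nat n)" by (intro sum_mono wN t z)
    also have "\<dots> \<le> 2" using sum_half_powers_le[OF finT[OF t z, of k], of 0] by simp
    finally show ?thesis using h0 by simp
  qed
  have equicont: "\<exists>d. 0 < d \<and> (\<forall>k t. t \<in> {0..1} \<and> norm (t0 - t) < d \<longrightarrow> norm (hk k t0 - hk k t) < e)"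
    if t0: "t0 \<in> {0..1}" and e: "0 < e" for t0 e
  proof -
    obtain M where M: "(1/2 :: real) ^ M < e / 8" using real_arch_pow_inv[of "e/8" "1/2"] e by auto
    have "\<exists>d>0. \<forall>k. \<forall>t\<in>{0..1}. \<bar>t - t0\<bar> < d \<longrightarrow> letter_dist n (f k t0) (f k t) \<le> e / 8" for n
      using letter_dist_small[OF \<alpha> t0, of "e/8" n] e f(1) by (meson divide_pos_pos zero_less_numeral)
    then obtain D where D: "\<And>n. D n > 0" "\<And>n k t. t \<in> {0..1} \<Longrightarrow> \<bar>t - t0\<bar> < D n \<Longrightarrow> letter_dist n (f k t0) (f k t) \<le> e / 8"
      by metis
    define S where "S = {n :: int. to_nat n < M}"
    have "S \<subseteq> from_nat ` {..<M}" unfolding S_def by (metis (mono_tags, lifting) from_nat_to_nat image_eqI lessThan_iff mem_Collect_eq subsetI)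
    then have finS: "finite S" using finite_surj by blast
    define d where "d = Min (insert 1 (D ` S))"
    have d0: "d > 0" unfolding d_def using finS D(1) by (subst Min_gr_iff) auto
    have dD: "d \<le> D n" if "n \<in> S" for n unfolding d_def using finS that by (intro Min_le) auto
    have "\<bar>hk k t0 - hk k t\<bar> < e" if t: "t \<in> {0..1}" "\<bar>t0 - t\<bar> < d" for k t
    proof -
      let ?T = "T k t0 t"
      note fin = finT[OF t0 t(1), of k]
      have "\<bar>hk k t0 - hk k t\<bar> \<le> (\<Sum>n\<in>?T. \<omega> n * letter_dist n (f k t0) (f k t))"
        using diff[OF t0 t(1), of k] wd[OF t0 t(1), of k] by simp
      also have "\<dots> = (\<Sum>n\<in>?T \<inter> S. \<omega> n * letter_dist n (f k t0) (f k t)) + (\<Sum>n\<in>?T - S. \<omega> n * letter_dist n (f k t0) (f k t))"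
        by (subst add.commute, rule sum.Int_Diff[OF fin, of _ S, simplified add.commute])
      also have "(\<Sum>n\<in>?T - S. \<omega> n * letter_dist n (f k t0) (f k t)) \<le> (\<Sum>n\<in>?T - S. (1/2) ^ to_nat n)"
        by (intro sum_mono wN t0 t(1))
      also have "\<dots> \<le> 2 * (1/2) ^ M" by (rule sum_half_powers_le) (use fin in \<open>auto simp: S_def\<close>)
      also have "(\<Sum>n\<in>?T \<inter> S. \<omega> n * letter_dist n (f k t0) (f k t)) \<le> (\<Sum>n\<in>?T \<inter> S. (1/2) ^ to_nat n * (e / 8))"
      proof (rule sum_mono, rule mult_mono)
        fix n assume "n \<in> ?T \<inter> S"
        then show "letter_dist n (f k t0) (f k t) \<le> e / 8" using D(2)[OF t(1), of n k] dD[of n] t(2) by auto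
        show "0 \<le> letter_dist n (f k t0) (f k t)" unfolding letter_dist_def by (rule word_dist_nonneg) auto
      qed (use wle in auto)
      also have "\<dots> = (\<Sum>n\<in>?T \<inter> S. (1/2) ^ to_nat n) * (e / 8)" by (simp only: sum_distrib_right)
      also have "(\<Sum>n\<in>?T \<inter> S. (1/2 :: real) ^ to_nat n) * (e / 8) \<le> 2 * (e / 8)"
        using sum_half_powers_le[of "?T \<inter> S" 0] fin e by (intro mult_right_mono) auto
      finally show ?thesis using M e by linarith
    qed
    then show ?thesis using d0 by auto
  qed
  obtain h r where h: "continuous_on {0..1} h" "strict_mono (r :: nat \<Rightarrow> nat)"
    "\<And>e. 0 < e \<Longrightarrow> \<exists>N. \<forall>n x. n \<ge> N \<and> x \<in> {0..1} \<longrightarrow> norm (hk (r n) x - h x) < e"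
    using Arzela_Ascoli[of "{0..1::real}" hk 2] bound equicont by (metis compact_Icc)
  have lim: "(\<lambda>n. hk (r n) x) \<longlonglongrightarrow> h x" if "x \<in> {0..1}" for x
    unfolding LIMSEQ_iff using h(3) that by meson
  show ?thesis
  proof (rule that[OF h(1)])
    show "h 0 = 0" "h 1 = 0" using lim[of 0] lim[of 1] h0 LIMSEQ_const_iff[of 0] by auto
    show "0 \<le> h t" if "t \<in> {0..1}" for t
      by (rule LIMSEQ_le_const[OF lim[OF that]]) (use hnn in auto)
  next
    fix s t :: real assume st: "0 \<le> s" "s \<le> t" "t \<le> 1" and eq: "h s = h t" and min: "\<forall>r\<in>{s..t}. h s \<le> h r"
    have s: "s \<in> {0..1}" and t: "t \<in> {0..1}" using st by auto
    show "same_spot (\<alpha> s) (\<alpha> t)"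
    proof (rule ccontr)
      assume "\<not> same_spot (\<alpha> s) (\<alpha> t)"
      moreover have "\<alpha> s \<in> model" "\<alpha> t \<in> model" using s t \<alpha>(2) by auto
      ultimately have "\<exists>n d. d > 0 \<and> (\<forall>k g g'. n \<le> k \<longrightarrow> g \<in> fiber k (\<alpha> s) \<longrightarrow> g' \<in> fiber k (\<alpha> t) \<longrightarrow>
             (\<exists>v. fst (hd v) = n \<and> d \<le> \<bar>g v - g' v\<bar>))"
        using fiber_separates by blast
      then obtain n d where d: "d > 0" "\<And>k g g'. n \<le> k \<Longrightarrow> g \<in> fiber k (\<alpha> s) \<Longrightarrow> g' \<in> fiber k (\<alpha> t) \<Longrightarrow>
             (\<exists>v. fst (hd v) = n \<and> d \<le> \<bar>g v - g' v\<bar>)"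
        by meson
      define e where "e = \<omega> n * d / 5"
      have e: "e > 0" using w0[of n] d(1) by (simp add: e_def)
      obtain N where N: "\<And>j x. j \<ge> N \<Longrightarrow> x \<in> {0..1} \<Longrightarrow> \<bar>hk (r j) x - h x\<bar> < e"
        using h(3)[OF e] by (metis real_norm_def)
      define j where "j = max N (nat n)"
      have "nat n \<le> r j" using seq_suble[OF h(2), of j] by (simp add: j_def)
      then have nk: "n \<le> int (r j)" by simp
      let ?f = "f (r j)"
      have "?f s \<in> fiber (int (r j)) (\<alpha> s)" "?f t \<in> fiber (int (r j)) (\<alpha> t)"
        using f(1)[of "r j"] s t by (auto simp: is_lift_def)
      then obtain v where v: "fst (hd v) = n" "d \<le> \<bar>?f s v - ?f t v\<bar>" using d(2)[OF nk] by blast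
      have "\<exists>x\<in>{s..t}. \<forall>v. ?f x v \<le> min (?f s v) (?f t v)"
      proof (rule tree_path_meet[OF _ _ st(2)])
        show "?f x \<in> tree" if "x \<in> {s..t}" for x using tr[of x "r j"] that st by auto
        show "continuous_on {s..t} (\<lambda>x. ?f x v)" for v
        proof (rule continuous_on_subset)
          show "continuous_on {0..1} (\<lambda>x. ?f x v)" using f(1)[of "r j"] by (auto simp: is_lift_def)
        qed (use st in auto)
      qed
      then obtain x where x: "x \<in> {s..t}" "\<And>v. ?f x v \<le> min (?f s v) (?f t v)" by blast
      have x01: "x \<in> {0..1}" using x st by auto
      have "\<omega> n * d \<le> \<omega> n * \<bar>?f s v - ?f t v\<bar>" using v(2) w0' by (intro mult_left_mono)
      also have "\<dots> \<le> word_dist \<omega> (?f s) (?f t)"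
        using word_dist_ge[OF tr[OF s, of "r j"] tr[OF t, of "r j"], of \<omega> v] w0' v(1) by simp
      also have "\<dots> \<le> hk (r j) s + hk (r j) t - 2 * hk (r j) x"
        unfolding hk_def by (rule height_meet[OF tr[OF s] tr[OF t] tr[OF x01] x(2) w0'])
      also have "\<dots> \<le> h s + h t - 2 * h x + 4 * e"
        using N[of j s] N[of j t] N[of j x] s t x01 by (auto simp: j_def abs_less_iff)
      also have "\<dots> \<le> 4 * e" using min x(1) eq by auto
      finally show False using e unfolding e_def by linarith
    qed
  qed
qed

section \<open>The upward flow on the model\<close>

text \<open>
  The factor rescales a circle of radius \<open>R\<close> to radius \<open>1 / (1 / R + s)\<close>, using
  \<open>(norm p)\<^sup>2 = 2 * R * fst p\<close>; on the axis it is \<open>0 / 0 = 0\<close>, which does no harm.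
\<close>

definition flow :: "real \<Rightarrow> model_point \<Rightarrow> model_point" where
  "flow s z = (fst z + s, (2 * fst (snd z) / (2 * fst (snd z) + s * (norm (snd z))\<^sup>2)) *\<^sub>R snd z)"

lemma flow_off_axis:
  assumes z: "z \<in> model" "snd z \<noteq> 0" and s: "0 < of_int (circ z) + fst z + s"
  shows "flow s z = (fst z + s, ((of_int (circ z) + fst z) / (of_int (circ z) + fst z + s)) *\<^sub>R snd z)"
proof -
  define q where "q = of_int (circ z) + fst z"
  have q: "2 * fst (snd z) = q * (norm (snd z))\<^sup>2" "1 \<le> q" using model_off_axis[OF z] by (auto simp: q_def)
  have "2 * fst (snd z) / (2 * fst (snd z) + s * (norm (snd z))\<^sup>2) = (q * (norm (snd z))\<^sup>2) / ((q + s) * (norm (snd z))\<^sup>2)"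
    by (simp add: q(1) algebra_simps)
  also have "\<dots> = q / (q + s)" using z(2) by simp
  finally show ?thesis by (simp add: flow_def q_def)
qed

lemma flow_on_axis: "snd z = 0 \<Longrightarrow> flow s z = (fst z + s, 0)"
  by (simp add: flow_def)

lemma model_onI:
  assumes "1 \<le> of_int n + u" "(of_int n + u) * (norm p)\<^sup>2 = 2 * fst p"
  shows "(u, p) \<in> model"
  using assms by (auto simp: model_def)

lemma axis_in_model: "(u, 0) \<in> model"
proof (rule model_onI)
  show "1 \<le> of_int (\<lceil>1 - u\<rceil>) + u" by linarith
qed simp

lemma flow_in_model:
  assumes z: "z \<in> model" and s: "snd z \<noteq> 0 \<Longrightarrow> 1 \<le> of_int (circ z) + fst z + s"
  shows "flow s z \<in> model"
    and "snd z \<noteq> 0 \<Longrightarrow> snd (flow s z) \<noteq> 0 \<and> circ (flow s z) = circ z \<and> ang (flow s z) = ang z"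
proof -
  have *: "flow s z \<in> model \<and> snd (flow s z) \<noteq> 0 \<and> circ (flow s z) = circ z \<and> ang (flow s z) = ang z"
    if nz: "snd z \<noteq> 0"
  proof -
    define q r where "q = of_int (circ z) + fst z" and "r = q + s"
    have q: "q * (norm (snd z))\<^sup>2 = 2 * fst (snd z)" "1 \<le> q" "1 \<le> r"
      using model_off_axis[OF z nz] s nz by (auto simp: q_def r_def)
    have f: "flow s z = (fst z + s, (q / r) *\<^sub>R snd z)"
      using flow_off_axis[OF z nz, of s] s[OF nz] by (simp add: q_def r_def)
    have pos: "0 < q / r" using q by simp
    have eq: "(of_int (circ z) + (fst z + s)) * (norm ((q / r) *\<^sub>R snd z))\<^sup>2 = 2 * fst ((q / r) *\<^sub>R snd z)"
    proof -
      have "(of_int (circ z) + (fst z + s)) = r" by (simp add: q_def r_def)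
      moreover have "(norm ((q / r) *\<^sub>R snd z))\<^sup>2 = (q / r)\<^sup>2 * (norm (snd z))\<^sup>2"
        using q by (simp add: power_mult_distrib power_divide)
      moreover have "r * ((q / r)\<^sup>2 * (norm (snd z))\<^sup>2) = (q / r) * (q * (norm (snd z))\<^sup>2)"
        using q by (simp add: power2_eq_square)
      ultimately show ?thesis by (simp add: q(1))
    qed
    have m: "flow s z \<in> model"
      unfolding f by (rule model_onI[OF _ eq]) (use q in \<open>simp add: q_def r_def\<close>)
    have n0: "snd (flow s z) \<noteq> 0" using f nz q by simp
    have "of_int (circ (flow s z)) + fst (flow s z) = 2 * fst (snd (flow s z)) / (norm (snd (flow s z)))\<^sup>2"
      using model_off_axis(3)[OF m n0] by simp
    also have "\<dots> = of_int (circ z) + (fst z + s)"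
    proof -
      have "(norm (snd (flow s z)))\<^sup>2 \<noteq> 0" using n0 by simp
      moreover have "(of_int (circ z) + (fst z + s)) * (norm (snd (flow s z)))\<^sup>2 = 2 * fst (snd (flow s z))"
        using eq by (simp only: f snd_conv)
      ultimately show ?thesis by (metis nonzero_mult_div_cancel_right)
    qed
    finally have "circ (flow s z) = circ z" by (simp add: f)
    moreover have "ang (flow s z) = ang z"
    proof -
      have "snd ((q / r) *\<^sub>R snd z) / norm ((q / r) *\<^sub>R snd z) = (q / r) * snd (snd z) / ((q / r) * norm (snd z))"
        using pos q by (simp del: times_divide_eq_left times_divide_eq_right)
      also have "\<dots> = snd (snd z) / norm (snd z)" using pos by (metis less_irrefl mult_divide_mult_cancel_left)
      finally show ?thesis by (simp add: ang_def f)
    qed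
    ultimately show ?thesis using m n0 by blast
  qed
  show "flow s z \<in> model"
    using * axis_in_model by (cases "snd z = 0") (auto simp: flow_on_axis)
  show "snd z \<noteq> 0 \<Longrightarrow> snd (flow s z) \<noteq> 0 \<and> circ (flow s z) = circ z \<and> ang (flow s z) = ang z"
    using * by blast
qed

lemma flow_0: "z \<in> model \<Longrightarrow> flow 0 z = z"
  using flow_off_axis[of z 0] model_off_axis(1)[of z] by (cases "snd z = 0") (auto simp: flow_on_axis prod_eq_iff)

lemma flow_in_model_nonneg: "z \<in> model \<Longrightarrow> 0 \<le> s \<Longrightarrow> flow s z \<in> model"
  using flow_in_model(1)[of z s] model_off_axis(1)[of z] by force

lemma norm_flow_le:
  assumes z: "z \<in> model" and s: "0 \<le> s"
  shows "norm (snd (flow s z)) \<le> norm (snd z)"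
proof (cases "snd z = 0")
  case False
  have q: "1 \<le> of_int (circ z) + fst z" using model_off_axis[OF z False] by simp
  define c where "c = (of_int (circ z) + fst z) / (of_int (circ z) + fst z + s)"
  have "0 \<le> c" "c \<le> 1" using q s by (simp_all add: c_def divide_le_eq)
  moreover have "snd (flow s z) = c *\<^sub>R snd z"
    using flow_off_axis[OF z False, of s] q s by (simp add: c_def)
  ultimately show ?thesis by (simp add: mult_left_le_one_le)
qed (simp add: flow_on_axis)

lemma continuous_on_flow: "continuous_on ({0..} \<times> model) (\<lambda>x :: real \<times> model_point. flow (fst x) (snd x))"
  unfolding continuous_on_def
proof
  fix x :: "real \<times> model_point" assume x: "x \<in> {0..} \<times> model"
  let ?F = "at x within {0..} \<times> model"
  have h: "((\<lambda>x. fst (snd x) + fst x) \<longlongrightarrow> fst (snd x) + fst x) ?F" by (intro tendsto_intros)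
  have p: "((\<lambda>x. snd (flow (fst x) (snd x))) \<longlongrightarrow> snd (flow (fst x) (snd x))) ?F"
  proof (cases "snd (snd x) = 0")
    case True
    have "((\<lambda>x. snd (flow (fst x) (snd x))) \<longlongrightarrow> 0) ?F"
    proof (rule Lim_null_comparison)
      show "\<forall>\<^sub>F y in ?F. norm (snd (flow (fst y) (snd y))) \<le> norm (snd (snd y))"
        unfolding eventually_at_filter by (intro always_eventually allI impI norm_flow_le) auto
      have "((\<lambda>y. norm (snd (snd y))) \<longlongrightarrow> norm (snd (snd x))) ?F" by (intro tendsto_intros)
      then show "((\<lambda>y. norm (snd (snd y))) \<longlongrightarrow> 0) ?F" using True by simp
    qed
    then show ?thesis using True by (simp add: flow_on_axis)
  next
    case False
    have "fst (snd (snd x)) > 0" using x False model_off_axis(4) by (auto simp: mem_Times_iff)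
    then have "2 * fst (snd (snd x)) + fst x * (norm (snd (snd x)))\<^sup>2 \<noteq> 0"
      using x by (metis add_pos_nonneg less_irrefl mem_Times_iff mult_nonneg_nonneg atLeast_iff zero_le_power2 mult_pos_pos zero_less_numeral)
    then show ?thesis unfolding flow_def snd_conv by (intro tendsto_intros)
  qed
  show "((\<lambda>x. flow (fst x) (snd x)) \<longlongrightarrow> flow (fst x) (snd x)) ?F"
    using tendsto_Pair[OF h p] by (simp add: flow_def)
qed

lemma same_spot_same_height:
  assumes z: "z \<in> model" "z' \<in> model" and eq: "fst z = fst z'" "same_spot z z'"
  shows "z = z'"
proof (cases "snd z = 0")
  case True
  then show ?thesis using eq by (simp add: same_spot_def prod_eq_iff)
next
  case False
  then have nz': "snd z' \<noteq> 0" and c: "circ z = circ z'" "ang z = ang z'" using eq(2) by (auto simp: same_spot_def)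
  let ?q = "of_int (circ z) + fst z :: real"
  have *: "snd w = (2 * (x / ?q)) *\<^sub>R (x, 1 - 2 * ang w)"
    if w: "w \<in> model" "snd w \<noteq> 0" "circ w = circ z" "fst w = fst z" and x: "x = 2 * sqrt (ang w * (1 - ang w))" for w x
  proof -
    define N where "N = norm (snd w)"
    have N: "N > 0" using w by (simp add: N_def)
    have q: "1 \<le> ?q" "?q * N\<^sup>2 = 2 * fst (snd w)" "ang w * (1 - ang w) = (?q * N)\<^sup>2 / 16"
      using model_off_axis(1,2,7)[OF w(1,2)] w(3,4) by (auto simp: N_def)
    have "sqrt (ang w * (1 - ang w)) = ?q * N / 4"
      unfolding q(3) using q(1) N by (intro real_sqrt_unique) (auto simp: power_divide)
    then have xN: "x = ?q * N / 2" using x by simp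
    have Nx: "2 * (x / ?q) = N"
    proof -
      have "2 * (c * N / 2 / c) = N" if "1 \<le> c" for c :: real using that by simp
      then show ?thesis using q(1) unfolding xN by blast
    qed
    have "N * x = (?q * N\<^sup>2) / 2" unfolding xN by (simp add: power2_eq_square)
    then have "N * x = fst (snd w)" unfolding q(2) by simp
    moreover have "N * (1 - 2 * ang w) = snd (snd w)"
    proof -
      have "1 - 2 * ((1 - c) / 2) = c" for c :: real by (simp add: field_simps)
      then have "1 - 2 * ang w = snd (snd w) / N" unfolding ang_def N_def .
      then show ?thesis using N by simp
    qed
    ultimately show ?thesis unfolding Nx by (simp add: prod_eq_iff)
  qed
  have "snd z = snd z'"
    using *[OF z(1) False refl refl refl] *[OF z(2) nz' c(1)[symmetric] eq(1)[symmetric] refl] c(2) by simp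
  then show ?thesis using eq(1) by (simp add: prod_eq_iff)
qed

lemma homotopic_paths_model_constI:
  assumes \<alpha>: "path \<alpha>" "path_image \<alpha> \<subseteq> model" "\<alpha> 0 = \<alpha> 1" "\<alpha> 0 = (0, 0)"
    and lifts: "\<And>k::nat. \<exists>g. path g \<and> path_image g \<subseteq> tree_cover (int k) \<and>
                  g 0 = ((0, 0), emb (vert [])) \<and> g 1 = ((0, 0), emb (vert [])) \<and> (\<forall>t\<in>{0..1}. fst (g t) = \<alpha> t)"
  shows "homotopic_paths model \<alpha> (linepath (\<alpha> 0) (\<alpha> 0))"
proof -
  have c: "continuous_on {0..1} \<alpha>" and im: "\<alpha> ` {0..1} \<subseteq> model" using \<alpha> by (auto simp: path_def path_image_def)
  have am: "\<alpha> t \<in> model" if "t \<in> {0..1}" for t using im that by auto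
  obtain g where g: "\<And>k::nat. path (g k) \<and> path_image (g k) \<subseteq> tree_cover (int k) \<and>
                  g k 0 = ((0, 0), emb (vert [])) \<and> g k 1 = ((0, 0), emb (vert [])) \<and> (\<forall>t\<in>{0..1}. fst (g k t) = \<alpha> t)"
    using lifts by metis
  define f where "f k t = coord (snd (g k t))" for k t
  have lift: "is_lift \<alpha> (int k) (f k)" for k
    unfolding is_lift_def
  proof (intro conjI ballI allI)
    fix t :: real assume t: "t \<in> {0..1}"
    have "g k t \<in> tree_cover (int k)" using g[of k] t by (auto simp: path_image_def)
    then obtain z h where h: "g k t = (z, emb h)" "z \<in> model" "h \<in> fiber (int k) z" by (auto simp: tree_cover_def)
    moreover have "z = \<alpha> t" using g[of k] t h(1) by (metis fst_conv)
    ultimately show "f k t \<in> fiber (int k) (\<alpha> t)"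
      using fiber_subset_tree[OF h(2), of "int k"] coord_emb[of h] by (auto simp: f_def)
  next
    fix v
    have "continuous_on {0..1} (g k)" using g[of k] by (auto simp: path_def)
    then show "continuous_on {0..1} (\<lambda>t. f k t v)"
      unfolding f_def by (intro continuous_on_compose2[OF continuous_coord[of UNIV]] continuous_intros) auto
  qed
  have f01: "f k 0 = vert []" "f k 1 = vert []" for k
    using g[of k] coord_emb[OF vert_in_tree] by (auto simp: f_def)
  obtain h :: "real \<Rightarrow> real" where h: "continuous_on {0..1} h" "h 0 = 0" "h 1 = 0"
    "\<And>t. t \<in> {0..1} \<Longrightarrow> 0 \<le> h t"
    "\<And>s t. 0 \<le> s \<Longrightarrow> s \<le> t \<Longrightarrow> t \<le> 1 \<Longrightarrow> h s = h t \<Longrightarrow> \<forall>r\<in>{s..t}. h s \<le> h r \<Longrightarrow> same_spot (\<alpha> s) (\<alpha> t)"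
    using closed_lifts_tree_code[OF c im lift f01] by blast
  obtain N where N: "\<And>t. t \<in> {0..1} \<Longrightarrow> fst (\<alpha> t) \<le> N"
  proof -
    have "compact ((\<lambda>t. fst (\<alpha> t)) ` {0..1})" by (intro compact_continuous_image continuous_intros c) auto
    then have "bdd_above ((\<lambda>t. fst (\<alpha> t)) ` {0..1})" by (intro bounded_imp_bdd_above compact_imp_bounded)
    then show ?thesis using that unfolding bdd_above_def by blast
  qed
  define H where "H = (\<lambda>x. flow (fst x * (N - fst (\<alpha> (snd x)))) (\<alpha> (snd x)))"
  define \<beta> where "\<beta> t = flow (N - fst (\<alpha> t)) (\<alpha> t)" for t
  have cH: "continuous_on ({0..1} \<times> {0..1}) H"
  proof -
    have c2: "continuous_on ({0..1::real} \<times> {0..1::real}) (\<lambda>x. \<alpha> (snd x))"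
      by (intro continuous_on_compose2[OF c] continuous_intros) auto
    have "continuous_on ({0..1} \<times> {0..1}) (\<lambda>x. (\<lambda>x. flow (fst x) (snd x)) (fst x * (N - fst (\<alpha> (snd x))), \<alpha> (snd x)))"
      by (intro continuous_on_compose2[OF continuous_on_flow] continuous_intros c2) (use N am in auto)
    then show ?thesis by (simp add: H_def)
  qed
  have Him: "H x \<in> model" if "x \<in> {0..1} \<times> {0..1}" for x
    unfolding H_def using that N am by (intro flow_in_model_nonneg) auto
  have \<beta>H: "\<beta> t = H (1, t)" for t by (simp add: \<beta>_def H_def)
  have hom1: "homotopic_loops model \<alpha> \<beta>"
    unfolding homotopic_loops
    by (rule exI[of _ H])
      (use cH Him flow_0 am \<alpha>(3) in \<open>auto simp: \<beta>H H_def pathstart_def pathfinish_def\<close>)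
  have spot: "same_spot (\<alpha> t) (\<beta> t)" "\<beta> t \<in> model" "fst (\<beta> t) = N" if t: "t \<in> {0..1}" for t
  proof -
    have "snd (\<alpha> t) \<noteq> 0 \<Longrightarrow> 1 \<le> of_int (circ (\<alpha> t)) + fst (\<alpha> t) + (N - fst (\<alpha> t))"
      using model_off_axis(1)[OF am[OF t]] N[OF t] by linarith
    note F = flow_in_model[OF am[OF t] this]
    show "same_spot (\<alpha> t) (\<beta> t)" "\<beta> t \<in> model" "fst (\<beta> t) = N"
      using F by (auto simp: \<beta>_def same_spot_def flow_on_axis) (simp_all add: flow_def)
  qed
  have "homotopic_loops model \<beta> (linepath (\<beta> 0) (\<beta> 0))"
  proof (rule tree_coded_loop_nullhomotopic[OF _ _ h(1-4)])
    show "path \<beta>" using homotopic_loops_imp_path[OF hom1] by simp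
    show "path_image \<beta> \<subseteq> model" using homotopic_loops_imp_subset[OF hom1] by simp
    fix s t :: real
    assume st: "0 \<le> s" "s \<le> t" "t \<le> 1" "h s = h t" "\<forall>r\<in>{s..t}. h s \<le> h r"
    have s: "s \<in> {0..1}" and t: "t \<in> {0..1}" using st by auto
    have "same_spot (\<beta> s) (\<beta> t)" using h(5)[OF st] spot(1)[OF s] spot(1)[OF t] by (auto simp: same_spot_def)
    then show "\<beta> s = \<beta> t" using same_spot_same_height spot(2,3) s t by metis
  qed
  then have "homotopic_loops model \<alpha> (linepath (\<beta> 0) (\<beta> 0))" using hom1 homotopic_loops_trans by blast
  then show ?thesis using homotopic_loops_imp_homotopic_paths_null by (metis pathstart_def)
qed

section \<open>The telescope and its model\<close>

lemma top_of_set_prod: "prod_topology (top_of_set A) (top_of_set B) = top_of_set (A \<times> B)"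
proof -
  have "prod_topology euclidean euclidean = (euclidean :: ('a \<times> 'b) topology)"
    unfolding topology_eq openin_prod_topology_alt open_openin[symmetric] open_prod_def by fastforce
  then show ?thesis using subtopology_Times[of euclidean euclidean A B] by simp
qed

lemma earring_iff_model: "p \<in> earring \<longleftrightarrow> (of_int i, p) \<in> model"
proof -
  obtain x y where p: "p = (x, y)" by (cases p)
  have N: "(norm p)\<^sup>2 = x\<^sup>2 + y\<^sup>2" by (simp add: p norm_prod_def)
  show ?thesis
  proof
    assume "p \<in> earring"
    then obtain m where m: "m \<ge> 1" "real m * (x\<^sup>2 + y\<^sup>2) = 2 * x"
      using earring_circle_iff[of _ x y] by (auto simp: earring_def p)
    show "(of_int i, p) \<in> model"
      by (rule model_onI[of "int m - i"]) (use m N in \<open>auto simp: p\<close>)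
  next
    assume "(of_int i, p) \<in> model"
    then obtain n :: int where n: "1 \<le> of_int n + real_of_int i" "(of_int n + of_int i) * (x\<^sup>2 + y\<^sup>2) = 2 * x"
      using N by (auto simp: model_def p)
    then have "n + i \<ge> 1" by linarith
    then have "real (nat (n + i)) = of_int n + of_int i" "nat (n + i) \<ge> 1" by auto
    then have "p \<in> earring_circle (nat (n + i))" using n(2) earring_circle_iff[of "nat (n + i)" x y] by (simp add: p)
    then show "p \<in> earring" using \<open>nat (n + i) \<ge> 1\<close> by (auto simp: earring_def)
  qed
qed

lemma compact_earring: "compact earring"
proof -
  have nb: "norm q \<le> 2 / real m" if "m \<ge> 1" "q \<in> earring_circle m" for m q
  proof -
    have "norm (q - (1 / real m, 0)) = 1 / real m" "norm ((1 / real m, 0) :: real \<times> real) = 1 / real m"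
      using that by (simp_all add: earring_circle_def dist_norm[symmetric] dist_commute)
    then show ?thesis using norm_triangle_ineq[of "q - (1 / real m, 0)" "(1 / real m, 0)"] by simp
  qed
  have "bounded earring"
  proof (rule boundedI)
    fix q assume "q \<in> earring"
    then obtain m where m: "m \<ge> 1" "q \<in> earring_circle m" by (auto simp: earring_def)
    have "2 / real m \<le> 2" using m(1) by (simp add: divide_le_eq)
    then show "norm q \<le> 2" using nb[OF m] by linarith
  qed
  moreover have "closed earring"
    unfolding closed_def open_dist
  proof
    fix p assume p: "p \<in> - earring"
    have "(0 :: real \<times> real) \<in> earring_circle 1" by (simp add: earring_circle_def norm_prod_def dist_norm)
    then have "p \<noteq> 0" using p by (auto simp: earring_def)
    define r where "r = norm p / 2"
    have r: "r > 0" using \<open>p \<noteq> 0\<close> by (simp add: r_def)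
    obtain M :: nat where M: "2 / r < real M" using reals_Archimedean2 by blast
    define K where "K = (\<Union>m\<in>{1..M}. earring_circle m)"
    have "closed K" unfolding K_def by (intro closed_UN) (auto simp: earring_circle_def)
    then have "open (- K)" by auto
    moreover have "p \<in> - K" using p by (auto simp: K_def earring_def)
    ultimately obtain e where e: "e > 0" "\<And>q. dist q p < e \<Longrightarrow> q \<in> - K" unfolding open_dist by blast
    show "\<exists>e>0. \<forall>q. dist q p < e \<longrightarrow> q \<in> - earring"
    proof (intro exI conjI allI impI)
      show "min e r > 0" using e r by simp
      fix q assume q: "dist q p < min e r"
      have "norm p \<le> norm q + dist q p" using norm_triangle_ineq4[of q "q - p"] by (simp add: dist_norm)
      then have nq: "norm q > r" using q by (simp add: r_def)
      show "q \<in> - earring"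
      proof
        assume "q \<in> earring"
        then obtain m where m: "m \<ge> 1" "q \<in> earring_circle m" by (auto simp: earring_def)
        have "r < 2 / real m" using nb[OF m] nq by linarith
        then have "real m < 2 / r" using m(1) r by (simp add: field_simps)
        then have "m \<le> M" using M by linarith
        then show False using m e(2)[of q] q by (auto simp: K_def)
      qed
    qed
  qed
  ultimately show ?thesis by (simp add: compact_eq_bounded_closed)
qed

definition tele_map :: "cylinder_point \<Rightarrow> model_point" where
  "tele_map c = flow (snd (snd c)) (of_int (fst c), fst (snd c))"

lemma topspace_cylinders: "c \<in> topspace telescope_cylinders \<longleftrightarrow> fst (snd c) \<in> earring \<and> 0 \<le> snd (snd c) \<and> snd (snd c) \<le> 1"
  by (cases c) (auto simp: telescope_cylinders_def)

lemma tele_map_facts: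
  assumes "c \<in> topspace telescope_cylinders"
  shows "tele_map c \<in> model" "fst (tele_map c) = of_int (fst c) + snd (snd c)"
    "same_spot (of_int (fst c), fst (snd c)) (tele_map c)"
proof -
  have m: "(of_int (fst c), fst (snd c)) \<in> model" and t: "0 \<le> snd (snd c)"
    using assms earring_iff_model by (auto simp: topspace_cylinders)
  show "tele_map c \<in> model" unfolding tele_map_def by (rule flow_in_model_nonneg[OF m t])
  show "fst (tele_map c) = of_int (fst c) + snd (snd c)" by (simp add: tele_map_def flow_def)
  show "same_spot (of_int (fst c), fst (snd c)) (tele_map c)"
  proof (cases "fst (snd c) = 0")
    case True
    then show ?thesis by (simp add: tele_map_def same_spot_def flow_on_axis)
  next
    case False
    then show ?thesis
      using flow_in_model(2)[OF m, of "snd (snd c)"] model_off_axis(1)[OF m] t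
      by (simp add: tele_map_def same_spot_def)
  qed
qed

lemma same_spot_trans: "same_spot a b \<Longrightarrow> same_spot b c \<Longrightarrow> same_spot a c"
  by (auto simp: same_spot_def)

lemma tele_map_surj: "tele_map ` topspace telescope_cylinders = model"
proof (intro equalityI subsetI)
  fix z assume z: "z \<in> model"
  define i t where "i = \<lfloor>fst z\<rfloor>" and "t = fst z - of_int i"
  have t: "0 \<le> t" "t \<le> 1" unfolding t_def i_def by linarith+
  define w where "w = flow (- t) z"
  have "1 \<le> of_int (circ z) + fst z + - t" if "snd z \<noteq> 0"
  proof -
    have "1 \<le> of_int (circ z) + fst z" using model_off_axis(1)[OF z that] .
    then have "1 \<le> circ z + i" unfolding i_def by linarith
    then have "1 \<le> real_of_int (circ z + i)" by linarith
    then show ?thesis by (simp add: t_def)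
  qed
  note F = flow_in_model[OF z this]
  have w: "w \<in> model" "same_spot z w" using F by (auto simp: w_def same_spot_def flow_on_axis)
  have wf: "w = (of_int i, snd w)" by (simp add: w_def flow_def t_def)
  define c where "c = (i, (snd w, t))"
  have c: "c \<in> topspace telescope_cylinders"
    using t w(1) wf earring_iff_model[of "snd w" i] by (simp add: c_def topspace_cylinders)
  have "tele_map c = z"
  proof (rule same_spot_same_height[OF tele_map_facts(1)[OF c] z])
    show "fst (tele_map c) = fst z" using tele_map_facts(2)[OF c] by (simp add: c_def t_def)
    have "same_spot w (tele_map c)" using tele_map_facts(3)[OF c] wf by (simp add: c_def)
    then show "same_spot (tele_map c) z" using w(2) same_spot_trans same_spot_sym by blast
  qed
  then show "z \<in> tele_map ` topspace telescope_cylinders" using c by blast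
qed (use tele_map_facts(1) in auto)

lemma earring_shift_in_earring: "p \<in> earring \<Longrightarrow> earring_shift p \<in> earring"
  using is_earring_shift_earring_shift by (auto simp: is_earring_shift_def continuous_map_def)

lemma flow_1_earring:
  assumes "p \<in> earring"
  shows "flow 1 (of_int i, p) = (of_int i + 1, earring_shift p)"
proof -
  obtain m t where m: "m \<ge> 1" "t \<in> {0..1}" and p: "p = earring_loop m t" using earring_loop_cases[OF assms] .
  have m0: "real m > 0" using m by simp
  have sh: "earring_shift p = earring_loop (m + 1) t"
    using is_earring_shift_earring_shift m p by (simp add: is_earring_shift_def)
  have sc: "earring_loop (m + 1) t = (real m / (real m + 1)) *\<^sub>R p"
    using m0 by (simp add: p earring_loop_def add.commute)
  show ?thesis
  proof (cases "p = 0")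
    case True
    then show ?thesis using sh sc by (simp add: flow_def)
  next
    case False
    have "(fst p, snd p) \<in> earring_circle m" using earring_loop_in_circle[OF m(1)] by (simp add: p)
    then have e: "2 * fst p = real m * (norm p)\<^sup>2"
      using earring_circle_iff[OF m(1), of "fst p" "snd p"] by (simp add: norm_prod_def)
    have "2 * fst p / (2 * fst p + 1 * (norm p)\<^sup>2) = (real m * (norm p)\<^sup>2) / ((real m + 1) * (norm p)\<^sup>2)"
      unfolding e by (simp add: distrib_right)
    also have "\<dots> = real m / (real m + 1)" using False by simp
    finally show ?thesis using sh sc by (simp add: flow_def)
  qed
qed

lemma tele_map_glue:
  assumes "telescope_glue c c'" shows "tele_map c = tele_map c'"
proof -
  obtain i x where x: "x \<in> earring" "c = (i, (x, 1))" "c' = (i + 1, (earring_shift x, 0))"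
    using assms by (auto simp: telescope_glue_def)
  have "(of_int (i + 1), earring_shift x) \<in> model" using earring_iff_model earring_shift_in_earring x by blast
  then show ?thesis using flow_1_earring[OF x(1), of i] flow_0 by (simp add: x tele_map_def)
qed

lemma tele_map_equivclp: "equivclp telescope_glue c c' \<Longrightarrow> tele_map c = tele_map c'"
  by (induction rule: equivclp_induct) (auto dest: tele_map_glue)

lemma tele_map_eq_imp:
  assumes c: "c \<in> topspace telescope_cylinders" "c' \<in> topspace telescope_cylinders" and eq: "tele_map c = tele_map c'"
  shows "equivclp telescope_glue c c'"
proof -
  have *: "equivclp telescope_glue c c'"
    if c: "c \<in> topspace telescope_cylinders" "c' \<in> topspace telescope_cylinders" and eq: "tele_map c = tele_map c'"
      and le: "fst c \<le> fst c'" for c c'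
  proof -
    have h: "of_int (fst c) + snd (snd c) = of_int (fst c') + snd (snd c')"
      using tele_map_facts(2)[OF c(1)] tele_map_facts(2)[OF c(2)] eq by simp
    have b: "0 \<le> snd (snd c)" "snd (snd c) \<le> 1" "0 \<le> snd (snd c')" "snd (snd c') \<le> 1"
      using c by (auto simp: topspace_cylinders)
    have inj: "d = d'" if d: "d \<in> topspace telescope_cylinders" "d' \<in> topspace telescope_cylinders"
      and e: "tele_map d = tele_map d'" "fst d = fst d'" for d d'
    proof -
      have "snd (snd d) = snd (snd d')" using tele_map_facts(2)[OF d(1)] tele_map_facts(2)[OF d(2)] e by simp
      moreover have "same_spot (of_int (fst d), fst (snd d)) (of_int (fst d'), fst (snd d'))"
        using same_spot_trans[OF tele_map_facts(3)[OF d(1)]] same_spot_sym[OF tele_map_facts(3)[OF d(2)]] e(1) by simp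
      then have "(of_int (fst d), fst (snd d)) = ((of_int (fst d'), fst (snd d')) :: model_point)"
        by (rule same_spot_same_height[rotated 3])
          (use d e(2) earring_iff_model in \<open>auto simp: topspace_cylinders\<close>)
      ultimately show ?thesis using e(2) by (simp add: prod_eq_iff)
    qed
    consider "fst c = fst c'" | "fst c' = fst c + 1" "snd (snd c) = 1" "snd (snd c') = 0"
    proof -
      have "of_int (fst c') \<le> real_of_int (fst c) + 1" using h b by linarith
      then have "fst c' \<le> fst c + 1" by linarith
      then consider "fst c = fst c'" | "fst c' = fst c + 1" using le by linarith
      then show ?thesis using that h b by cases auto
    qed
    then show ?thesis
    proof cases
      case 1
      then show ?thesis using inj[OF c eq] by simp
    next
      case 2
      define d where "d = (fst c + 1, (earring_shift (fst (snd c)), 0 :: real))"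
      have x: "fst (snd c) \<in> earring" using c by (simp add: topspace_cylinders)
      have g: "telescope_glue c d" using x 2 by (auto simp: telescope_glue_def d_def prod_eq_iff)
      have "d \<in> topspace telescope_cylinders" using earring_shift_in_earring[OF x] by (simp add: d_def topspace_cylinders)
      then have "d = c'" using inj[of d c'] c(2) tele_map_glue[OF g] eq 2 by (simp add: d_def)
      then show ?thesis using g by (auto intro: r_into_equivclp)
    qed
  qed
  show ?thesis
  proof (cases "fst c \<le> fst c'")
    case True then show ?thesis using * c eq by blast
  next
    case False then show ?thesis using *[OF c(2,1) eq[symmetric]] by (simp add: equivclp_sym)
  qed
qed

lemma quotient_map_tele_map: "quotient_map telescope_cylinders (top_of_set model) tele_map"
proof (rule continuous_closed_imp_quotient_map)
  have cyl: "telescope_cylinders = sum_topology (\<lambda>i. top_of_set (earring \<times> {0..1})) UNIV"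
    by (simp add: telescope_cylinders_def top_of_set_prod)
  have cont: "continuous_on (earring \<times> {0..1}) (\<lambda>x. tele_map (i, x))" for i
  proof -
    have "continuous_on (earring \<times> {0..1}) (\<lambda>x. (\<lambda>x. flow (fst x) (snd x)) (snd x, (of_int i, fst x)))"
      by (intro continuous_on_compose2[OF continuous_on_flow] continuous_intros)
        (use earring_iff_model in auto)
    then show ?thesis by (simp add: tele_map_def)
  qed
  have im: "(\<lambda>x. tele_map (i, x)) ` (earring \<times> {0..1}) \<subseteq> model" for i
    using tele_map_facts(1) by (auto simp: topspace_cylinders)
  show "continuous_map telescope_cylinders (top_of_set model) tele_map"
    unfolding continuous_map_def
  proof (intro conjI allI impI)
    show "tele_map \<in> topspace telescope_cylinders \<rightarrow> topspace (top_of_set model)"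
      using tele_map_facts(1) by auto
    fix U assume U: "openin (top_of_set model) U"
    show "openin telescope_cylinders {c \<in> topspace telescope_cylinders. tele_map c \<in> U}"
      unfolding cyl openin_sum_topology
    proof (intro conjI ballI)
      fix i :: int
      have "openin (top_of_set (earring \<times> {0..1})) ((earring \<times> {0..1}) \<inter> (\<lambda>x. tele_map (i, x)) -` U)"
        by (rule continuous_openin_preimage[OF cont _ U]) (use im in auto)
      moreover have "{x. (i, x) \<in> {c \<in> topspace (sum_topology (\<lambda>i. top_of_set (earring \<times> {0..1})) UNIV). tele_map c \<in> U}}
          = (earring \<times> {0..1}) \<inter> (\<lambda>x. tele_map (i, x)) -` U" by auto
      ultimately show "openin (top_of_set (earring \<times> {0..1}))
          {x. (i, x) \<in> {c \<in> topspace (sum_topology (\<lambda>i. top_of_set (earring \<times> {0..1})) UNIV). tele_map c \<in> U}}"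
        by simp
    qed auto
  qed
  show "tele_map ` topspace telescope_cylinders = topspace (top_of_set model)" using tele_map_surj by simp
  show "closed_map telescope_cylinders (top_of_set model) tele_map"
    unfolding closed_map_def
  proof (intro allI impI)
    fix C assume C: "closedin telescope_cylinders C"
    have Csub: "C \<subseteq> topspace telescope_cylinders" using closedin_subset[OF C] .
    have comp: "compact (tele_map ` (Pair i ` {x. (i, x) \<in> C}))" for i
    proof -
      have "closedin (top_of_set (earring \<times> {0..1})) {x. (i, x) \<in> C}"
        using C by (simp add: cyl closedin_sum_topology)
      moreover have "compact (earring \<times> {0..1::real})" by (intro compact_Times compact_earring) auto
      ultimately have k: "compact {x. (i, x) \<in> C}" using closedin_compact by blast
      have s: "{x. (i, x) \<in> C} \<subseteq> earring \<times> {0..1}" using Csub topspace_cylinders by fastforce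
      have "compact ((\<lambda>x. tele_map (i, x)) ` {x. (i, x) \<in> C})"
        by (intro compact_continuous_image continuous_on_subset[OF cont s] k)
      then show ?thesis by (simp add: image_image)
    qed
    have "openin (top_of_set model) (model - tele_map ` C)"
      unfolding openin_euclidean_subtopology_iff
    proof (intro conjI ballI)
      fix z assume z: "z \<in> model - tele_map ` C"
      define F where "F = {\<lfloor>fst z\<rfloor> - 3..\<lfloor>fst z\<rfloor> + 3}"
      define K where "K = (\<Union>i\<in>F. tele_map ` (Pair i ` {x. (i, x) \<in> C}))"
      have "closed K" unfolding K_def using comp by (intro closed_UN compact_imp_closed) (auto simp: F_def)
      then have "open (- K)" by auto
      moreover have "z \<in> - K" using z by (auto simp: K_def)
      ultimately obtain e where e: "e > 0" "\<And>q. dist q z < e \<Longrightarrow> q \<in> - K" unfolding open_dist by blast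
      have "z' \<in> model - tele_map ` C" if z': "z' \<in> model" "dist z' z < min e 1" for z'
      proof
        show "z' \<notin> tele_map ` C"
        proof
          assume "z' \<in> tele_map ` C"
          then obtain c where c: "c \<in> C" "z' = tele_map c" by blast
          then have ct: "c \<in> topspace telescope_cylinders" using Csub by blast
          have "\<bar>of_int (fst c) + snd (snd c) - fst z\<bar> < 1"
            using tele_map_facts(2)[OF ct] c(2) z'(2) dist_fst_le[of z' z] by (auto simp: dist_real_def)
          moreover have "0 \<le> snd (snd c)" "snd (snd c) \<le> 1" using ct by (auto simp: topspace_cylinders)
          ultimately have "fst c \<in> F" unfolding F_def atLeastAtMost_iff by linarith
          then have "z' \<in> K" using c unfolding K_def by (intro UN_I[of "fst c"]) (auto simp: image_image intro!: image_eqI[of _ _ "snd c"])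
          then show False using e(2)[of z'] z' by auto
        qed
      qed (use z' in auto)
      then show "\<exists>e>0. \<forall>z'\<in>model. dist z' z < e \<longrightarrow> z' \<in> model - tele_map ` C"
        using e(1) by (intro exI[of _ "min e 1"]) auto
    qed auto
    moreover have "tele_map ` C \<subseteq> model" using tele_map_surj Csub by blast
    ultimately show "closedin (top_of_set model) (tele_map ` C)"
      by (simp add: closedin_def)
  qed
qed

proposition telescope_homeomorphic_model:
  obtains G G' where "homeomorphic_maps telescope (top_of_set model) G G'" "G telescope_base = (0, 0)"
proof -
  let ?q = "quotient_proj telescope_glue" and ?X = telescope_cylinders
  have qeq: "?q c = ?q c' \<longleftrightarrow> equivclp telescope_glue c c'" for c c'
  proof
    assume "?q c = ?q c'"
    moreover have "c' \<in> ?q c'" by (simp add: quotient_proj_def)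
    ultimately have "c' \<in> ?q c" by simp
    then show "equivclp telescope_glue c c'" by (simp add: quotient_proj_def)
  next
    assume "equivclp telescope_glue c c'"
    then show "?q c = ?q c'"
      unfolding quotient_proj_def by (blast intro: equivclp_trans equivclp_sym)
  qed
  define G where "G S = tele_map (SOME c. c \<in> topspace ?X \<and> ?q c = S)" for S
  have Gq: "G (?q c) = tele_map c" if c: "c \<in> topspace ?X" for c
  proof -
    define d where "d = (SOME d. d \<in> topspace ?X \<and> ?q d = ?q c)"
    have "?q d = ?q c"
      unfolding d_def by (rule someI2[of "\<lambda>d. d \<in> topspace ?X \<and> ?q d = ?q c" c]) (use c in simp_all)
    then have "tele_map d = tele_map c" using qeq tele_map_equivclp by blast
    then show ?thesis by (simp add: G_def d_def)
  qed
  have qm: "quotient_map ?X telescope ?q" unfolding telescope_def by (rule quotient_map_quotient_proj)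
  have "quotient_map ?X (top_of_set model) (G \<circ> ?q)"
    by (rule quotient_map_eq[OF quotient_map_tele_map]) (simp add: Gq)
  then have "quotient_map telescope (top_of_set model) G"
    using quotient_map_compose_eq[OF qm] by blast
  moreover have "inj_on G (topspace telescope)"
  proof (rule inj_onI)
    fix S S' assume "S \<in> topspace telescope" "S' \<in> topspace telescope" and eq: "G S = G S'"
    then obtain c c' where c: "c \<in> topspace ?X" "c' \<in> topspace ?X" "S = ?q c" "S' = ?q c'"
      by (auto simp: telescope_def topspace_quotient_topology)
    then show "S = S'" using eq Gq tele_map_eq_imp qeq by metis
  qed
  ultimately have "homeomorphic_map telescope (top_of_set model) G" by (simp add: homeomorphic_map_def)
  then obtain G' where "homeomorphic_maps telescope (top_of_set model) G G'" using homeomorphic_map_maps by blast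
  moreover have "G telescope_base = (0, 0)"
  proof -
    have b: "(0, ((0, 0), 0)) \<in> topspace ?X"
      using earring_iff_model[of 0 0] axis_in_model[of 0] by (simp add: topspace_cylinders zero_prod_def)
    show ?thesis unfolding telescope_base_def Gq[OF b] by (simp add: tele_map_def flow_def zero_prod_def)
  qed
  ultimately show ?thesis using that by blast
qed

lemma covering_projection_transport:
  assumes cov: "covering_space C p S"
    and G: "homeomorphic_maps X (top_of_set S) G G'" and J: "homeomorphic_maps E (top_of_set C) J J'"
  shows "covering_projection E (G' \<circ> p \<circ> J) X"
proof -
  let ?r = "G' \<circ> p \<circ> J"
  have cG: "continuous_map X (top_of_set S) G" "continuous_map (top_of_set S) X G'"
    and cJ: "continuous_map E (top_of_set C) J" "continuous_map (top_of_set C) E J'"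
    using G J by (auto simp: homeomorphic_maps_def)
  have iG: "G' (G x) = x" "G x \<in> S" if "x \<in> topspace X" for x
    using G that by (auto simp: homeomorphic_maps_def continuous_map_def)
  have iG': "G (G' y) = y" "G' y \<in> topspace X" if "y \<in> S" for y
    using G that by (auto simp: homeomorphic_maps_def continuous_map_def)
  have iJ: "J' (J x) = x" "J x \<in> C" if "x \<in> topspace E" for x
    using J that by (auto simp: homeomorphic_maps_def continuous_map_def)
  have iJ': "J (J' y) = y" "J' y \<in> topspace E" if "y \<in> C" for y
    using J that by (auto simp: homeomorphic_maps_def continuous_map_def)
  have pim: "p ` C = S" and cp: "continuous_on C p"
    using cov covering_space_imp_surjective covering_space_imp_continuous by auto
  have cr: "continuous_map E X ?r"
    by (intro continuous_map_compose[OF continuous_map_compose[OF cJ(1)] cG(2), unfolded o_assoc])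
      (use cp pim in \<open>auto simp: continuous_map_def[symmetric]\<close>)
  have sr: "?r ` topspace E = topspace X"
  proof (intro equalityI subsetI)
    fix x assume x: "x \<in> topspace X"
    then obtain y where y: "y \<in> C" "G x = p y" using iG(2) pim by blast
    then have "?r (J' y) = x" using iJ' iG(1)[OF x] by auto
    then show "x \<in> ?r ` topspace E" using iJ'(2)[OF y(1)] by blast
  qed (use iG' iJ pim in auto)
  have "\<exists>U. x \<in> U \<and> openin X U \<and> (\<exists>\<V>. \<Union>\<V> = {e \<in> topspace E. ?r e \<in> U} \<and> (\<forall>V\<in>\<V>. openin E V) \<and>
             pairwise disjnt \<V> \<and> (\<forall>V\<in>\<V>. homeomorphic_map (subtopology E V) (subtopology X U) ?r))"
    if x: "x \<in> topspace X" for x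
  proof -
    obtain T v where T: "G x \<in> T" "openin (top_of_set S) T" and v: "\<Union>v = C \<inter> p -` T"
      "\<forall>u\<in>v. openin (top_of_set C) u" "pairwise disjnt v" "\<forall>u\<in>v. \<exists>q. homeomorphism u T p q"
      using cov iG(2)[OF x] unfolding covering_space_def by meson
    define U where "U = {y \<in> topspace X. G y \<in> T}"
    define V where "V u = {e \<in> topspace E. J e \<in> u}" for u
    have TS: "T \<subseteq> S" using T(2) openin_imp_subset by blast
    have oU: "openin X U" unfolding U_def using openin_continuous_map_preimage[OF cG(1) T(2)] .
    have mem: "?r e \<in> U \<longleftrightarrow> p (J e) \<in> T" if "e \<in> topspace E" for e
      using iJ(2)[OF that] pim iG' by (auto simp: U_def)
    have "\<Union>(V ` v) = {e \<in> topspace E. ?r e \<in> U}"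
    proof -
      have "\<Union>(V ` v) = {e \<in> topspace E. J e \<in> \<Union>v}" by (auto simp: V_def)
      also have "\<dots> = {e \<in> topspace E. ?r e \<in> U}" unfolding v(1) using mem iJ(2) by auto
      finally show ?thesis .
    qed
    moreover have "\<forall>W\<in>V ` v. openin E W"
      using v(2) openin_continuous_map_preimage[OF cJ(1)] by (auto simp: V_def)
    moreover have "pairwise disjnt (V ` v)"
      using v(3) by (auto simp: pairwise_def V_def disjnt_def)
    moreover have "homeomorphic_map (subtopology E (V u)) (subtopology X U) ?r" if u: "u \<in> v" for u
    proof -
      have uC: "u \<subseteq> C" using v(1) u by blast
      have 1: "homeomorphic_map (subtopology E (V u)) (subtopology (top_of_set C) u) J"
      proof (rule homeomorphic_map_subtopologies)
        show "homeomorphic_map E (top_of_set C) J" using J by (simp add: homeomorphic_maps_map)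
        have "x \<in> J ` (topspace E \<inter> V u)" if "x \<in> u" for x
          using iJ'[of x] uC that by (intro image_eqI[of _ _ "J' x"]) (auto simp: V_def)
        then show "J ` (topspace E \<inter> V u) = topspace (top_of_set C) \<inter> u" using uC by (auto simp: V_def)
      qed
      obtain q where q: "homeomorphism u T p q" using v(4) u by blast
      have 2: "homeomorphic_map (top_of_set u) (top_of_set T) p"
        unfolding homeomorphic_map_maps homeomorphic_maps_def using q
        by (auto simp: homeomorphism_def intro!: exI[of _ q])
      have 3: "homeomorphic_map (subtopology (top_of_set S) T) (subtopology X U) G'"
      proof (rule homeomorphic_map_subtopologies)
        show "homeomorphic_map (top_of_set S) X G'" using G by (simp add: homeomorphic_maps_map)
        have "x \<in> G' ` (S \<inter> T)" if "x \<in> U" for x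
          using iG[of x] that by (intro image_eqI[of _ _ "G x"]) (auto simp: U_def)
        then show "G' ` (topspace (top_of_set S) \<inter> T) = topspace X \<inter> U" using iG' TS by (auto simp: U_def)
      qed
      have s: "subtopology (top_of_set C) u = top_of_set u" "subtopology (top_of_set S) T = top_of_set T"
        using uC TS by (simp_all add: subtopology_subtopology inf.absorb2)
      show ?thesis
        using homeomorphic_map_compose[OF homeomorphic_map_compose[OF 1[unfolded s] 2] 3[unfolded s]] by (simp add: o_assoc)
    qed
    ultimately show ?thesis
      using oU T(1) x by (intro exI[of _ U] conjI exI[of _ "V ` v"]) (auto simp: U_def)
  qed
  then show ?thesis unfolding covering_projection_def using cr sr by blast
qed

lemma homeomorphic_maps_pullback:
  assumes "inj_on \<iota> C"
  shows "homeomorphic_maps (pullback_topology (\<iota> ` C) (inv_into C \<iota>) (top_of_set C)) (top_of_set C) (inv_into C \<iota>) \<iota>"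
proof -
  let ?E = "pullback_topology (\<iota> ` C) (inv_into C \<iota>) (top_of_set C)"
  have "continuous_map ?E (top_of_set C) (id \<circ> inv_into C \<iota>)" by (rule continuous_map_pullback) simp
  moreover have "continuous_map (top_of_set C) ?E \<iota>"
  proof (rule continuous_map_pullback')
    show "continuous_map (top_of_set C) (top_of_set C) (inv_into C \<iota> \<circ> \<iota>)"
      by (rule continuous_map_eq[OF continuous_map_id]) (use assms in simp)
  qed auto
  ultimately show ?thesis
    using assms by (auto simp: homeomorphic_maps_def topspace_pullback_topology f_inv_into_f)
qed

text \<open>
  Any injection into the prescribed type of points would do: a function on the reals carries the
  point of the model on the negative numbers and the tree coordinates on the natural numbers.
\<close>

definition cover_code :: "model_point \<times> (nat \<Rightarrow>\<^sub>C real) \<Rightarrow> telescope_cover_point" where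
  "cover_code w = {\<lambda>r. if r < 0 then {(0, (snd (fst w), fst (fst w)))}
                       else {(0, ((apply_bcontfun (snd w) (nat \<lfloor>r\<rfloor>), 0), 0))}}"

lemma inj_cover_code: "inj cover_code"
proof (rule injI)
  fix w w' assume "cover_code w = cover_code w'"
  then have e: "(\<lambda>r::real. if r < 0 then {(0::int, (snd (fst w), fst (fst w)))} else {(0, ((apply_bcontfun (snd w) (nat \<lfloor>r\<rfloor>), 0), 0))})
     = (\<lambda>r. if r < 0 then {(0, (snd (fst w'), fst (fst w')))} else {(0, ((apply_bcontfun (snd w') (nat \<lfloor>r\<rfloor>), 0), 0))})"
    by (simp add: cover_code_def)
  have "fst w = fst w'" using fun_cong[OF e, of "-1"] by (simp add: prod_eq_iff)
  moreover have "apply_bcontfun (snd w) n = apply_bcontfun (snd w') n" for n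
    using fun_cong[OF e, of "real n"] by simp
  then have "snd w = snd w'" by (intro bcontfun_eqI)
  ultimately show "w = w'" by (simp add: prod_eq_iff)
qed

lemma homotopic_paths_iff_loops:
  assumes "f 0 = b" "f 1 = b"
  shows "homotopic_with (\<lambda>h. h 0 = b \<and> h 1 = b) (top_of_set {0..1}) (top_of_set S) f g \<longleftrightarrow> homotopic_paths S f g"
  using assms by (simp add: homotopic_paths_def pathstart_def pathfinish_def)

theorem corollary4p2:
  fixes a :: "(real \<Rightarrow> telescope_point) set"
  assumes "a \<in> carrier (fundamental_group telescope telescope_base)"
    and "a \<noteq> \<one>\<^bsub>fundamental_group telescope telescope_base\<^esub>"
  shows "\<exists>(E :: telescope_cover_point topology) e r.
           e \<in> topspace E \<and> r e = telescope_base \<and>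
           covering_projection E r telescope \<and>
           a \<notin> induced_hom telescope r e ` carrier (fundamental_group E e)"
proof (rule ccontr)
  assume neg: "\<not> ?thesis"
  let ?T = telescope and ?b = telescope_base and ?I = "top_of_set {0..1::real}"
  let ?P = "\<lambda>h. h 0 = telescope_base \<and> h 1 = telescope_base"
  obtain \<alpha> where \<alpha>: "pathin ?T \<alpha>" "\<alpha> 0 = ?b" "\<alpha> 1 = ?b" and a: "a = loop_class ?T ?b \<alpha>"
    using assms(1) by (auto simp: fundamental_group_def loops_at_def)
  obtain G G' where G: "homeomorphic_maps ?T (top_of_set model) G G'" and Gb: "G ?b = (0, 0)"
    using telescope_homeomorphic_model .
  have cG: "continuous_map ?T (top_of_set model) G" "continuous_map (top_of_set model) ?T G'"
    and GG: "\<And>x. x \<in> topspace ?T \<Longrightarrow> G' (G x) = x" "\<And>z. z \<in> model \<Longrightarrow> G (G' z) = z"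
    using G by (auto simp: homeomorphic_maps_def)
  have bT: "?b \<in> topspace ?T" using path_start_in_topspace[OF \<alpha>(1)] \<alpha>(2) by simp
  have "continuous_map ?I (top_of_set model) (G \<circ> \<alpha>)"
    using \<alpha>(1) cG(1) unfolding pathin_def by (rule continuous_map_compose)
  then have pG: "path (G \<circ> \<alpha>)" "path_image (G \<circ> \<alpha>) \<subseteq> model"
    by (auto simp: path_def path_image_def)
  have lift: "\<exists>g. path g \<and> path_image g \<subseteq> tree_cover (int k) \<and>
                  g 0 = ((0, 0), emb (vert [])) \<and> g 1 = ((0, 0), emb (vert [])) \<and> (\<forall>t\<in>{0..1}. fst (g t) = (G \<circ> \<alpha>) t)"
    for k :: nat
  proof -
    let ?C = "tree_cover (int k)" and ?c = "((0, 0), emb (vert []))"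
    define E where "E = pullback_topology (cover_code ` ?C) (inv_into ?C cover_code) (top_of_set ?C)"
    define J where "J = inv_into ?C cover_code"
    have inj: "inj_on cover_code ?C" using inj_cover_code inj_on_subset by blast
    have J: "homeomorphic_maps E (top_of_set ?C) J cover_code"
      unfolding E_def J_def by (rule homeomorphic_maps_pullback[OF inj])
    define r where "r = G' \<circ> fst \<circ> J"
    define e where "e = cover_code ?c"
    have "trivial_at (int k) (0, 0)" by (simp add: trivial_at_def)
    then have "vert [] \<in> fiber (int k) (0, 0)" by (auto simp: fiber_def intro!: imageI)
    then have cC: "?c \<in> ?C" using axis_in_model[of 0] unfolding tree_cover_def zero_prod_def by blast
    have Je: "J e = ?c" unfolding J_def e_def using inj cC by simp
    have eE: "e \<in> topspace E" using J cC by (auto simp: homeomorphic_maps_def continuous_map_def e_def)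
    have re: "r e = ?b" using Je GG(1)[OF bT] Gb by (simp add: r_def)
    have "covering_projection E r ?T"
      unfolding r_def by (rule covering_projection_transport[OF covering_space_tree_cover G J])
    then have "a \<in> induced_hom ?T r e ` carrier (fundamental_group E e)" using neg eE re by blast
    then obtain p where p: "pathin E p" "p 0 = e" "p 1 = e" and ap: "a = induced_hom ?T r e (loop_class E e p)"
      by (auto simp: fundamental_group_def loops_at_def)
    have cJ: "continuous_map E (top_of_set ?C) J" using J by (simp add: homeomorphic_maps_def)
    have cov: "covering_space ?C fst model" by (rule covering_space_tree_cover)
    have Jp: "continuous_map ?I (top_of_set ?C) (J \<circ> p)"
      using p(1) cJ unfolding pathin_def by (rule continuous_map_compose)
    have JpC: "J (p t) \<in> ?C" if "t \<in> {0..1}" for t using Jp that by (auto simp: continuous_map_def)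
    have "continuous_map ?I (top_of_set model) (fst \<circ> (J \<circ> p))"
      using Jp covering_space_imp_continuous[OF cov] covering_space_imp_surjective[OF cov]
      by (intro continuous_map_compose[OF Jp]) auto
    from continuous_map_compose[OF this cG(2)] have rp: "continuous_map ?I ?T (r \<circ> p)"
      by (simp only: r_def o_assoc)
    have pp: "p \<in> loop_class E e p" using p by (simp add: loop_class_def pathin_def)
    have "r \<circ> p \<in> loop_class ?T (r e) (r \<circ> p)" using rp p by (simp add: loop_class_def)
    then have "r \<circ> p \<in> a" unfolding ap induced_hom_def using pp by blast
    then have "homotopic_with ?P ?I ?T \<alpha> (r \<circ> p)" by (simp add: a loop_class_def)
    then have "homotopic_with (\<lambda>h. h 0 = (0, 0) \<and> h 1 = (0, 0)) ?I (top_of_set model) (G \<circ> \<alpha>) (G \<circ> (r \<circ> p))"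
      by (rule homotopic_with_compose_continuous_map_left[OF _ cG(1)]) (simp add: Gb)
    then have hp: "homotopic_paths model (G \<circ> (r \<circ> p)) (G \<circ> \<alpha>)"
      using homotopic_paths_iff_loops[of "G \<circ> \<alpha>" "(0, 0)"] \<alpha> Gb homotopic_paths_sym by auto
    have Jpath: "path (J \<circ> p)" "path_image (J \<circ> p) \<subseteq> ?C" using Jp by (auto simp: path_def path_image_def)
    have Jst: "pathstart (J \<circ> p) = ?c" "pathfinish (J \<circ> p) = ?c"
      using p Je by (simp_all add: pathstart_def pathfinish_def)
    have "fst ((J \<circ> p) t) = (G \<circ> (r \<circ> p)) t" if "t \<in> {0..1}" for t
    proof -
      have "fst (J (p t)) \<in> model" using JpC[OF that] covering_space_imp_surjective[OF cov] by blast
      then show ?thesis using GG(2) by (simp add: r_def)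
    qed
    from covering_space_lift_homotopic_path[OF cov hp Jpath Jst this]
    obtain g where "path g" "path_image g \<subseteq> ?C" "pathstart g = ?c" "pathfinish g = ?c"
      "\<And>t. t \<in> {0..1} \<Longrightarrow> fst (g t) = (G \<circ> \<alpha>) t" by metis
    then show ?thesis by (auto simp: pathstart_def pathfinish_def)
  qed
  have "homotopic_paths model (G \<circ> \<alpha>) (linepath ((G \<circ> \<alpha>) 0) ((G \<circ> \<alpha>) 0))"
    by (rule homotopic_paths_model_constI[OF pG _ _ lift]) (simp_all add: \<alpha> Gb)
  then have "homotopic_with (\<lambda>h. h 0 = (0, 0) \<and> h 1 = (0, 0)) ?I (top_of_set model) (G \<circ> \<alpha>) (linepath (0, 0) (0, 0))"
    using homotopic_paths_iff_loops[of "G \<circ> \<alpha>" "(0, 0)"] \<alpha> Gb by simp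
  then have "homotopic_with ?P ?I ?T (G' \<circ> (G \<circ> \<alpha>)) (G' \<circ> linepath (0, 0) (0, 0))"
    by (rule homotopic_with_compose_continuous_map_left[OF _ cG(2)]) (use GG(1)[OF bT] Gb in simp)
  moreover have "G' \<circ> linepath (0, 0) (0, 0) = (\<lambda>_. ?b)"
    using GG(1)[OF bT] Gb by (auto simp: linepath_refl)
  ultimately have push: "homotopic_with ?P ?I ?T (G' \<circ> (G \<circ> \<alpha>)) (\<lambda>_. ?b)" by simp
  have "homotopic_with ?P ?I ?T \<alpha> (G' \<circ> (G \<circ> \<alpha>))"
  proof (rule homotopic_with_equal)
    have "\<alpha> t \<in> topspace ?T" if "t \<in> {0..1}" for t
      using \<alpha>(1) that by (auto simp: pathin_def continuous_map_def)
    then show "\<alpha> t = (G' \<circ> (G \<circ> \<alpha>)) t" if "t \<in> topspace ?I" for t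
      using GG(1) that unfolding o_apply by simp
    show "continuous_map ?I ?T \<alpha>" using \<alpha>(1) by (simp add: pathin_def)
    show "?P (G' \<circ> (G \<circ> \<alpha>))" using GG(1)[OF bT] \<alpha>(2,3) by simp
  qed (use \<alpha> in simp)
  from homotopic_with_trans[OF this push]
  have null: "homotopic_with ?P ?I ?T \<alpha> (\<lambda>_. ?b)" .
  have "a = loop_class ?T ?b (\<lambda>_. ?b)"
    unfolding a loop_class_def
    using homotopic_with_trans[OF null] homotopic_with_trans[OF homotopic_with_symD[OF null]] by blast
  then show False using assms(2) by (simp add: fundamental_group_def)
qed

end
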